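(* Let $d\ge1$ be an integer and let $0<q<1$. Then $$\sup\Big\{F_q(\Omega)\ :\ \Omega\text{ open in }\mathbb{R}^d,\ 0<|\Omega|<\infty\Big\}=+\infty.$$
   Context: For an open set $\Omega\subset\mathbb{R}^d$ with Lebesgue measure $0<|\Omega|<\infty$: $\lambda(\Omega)=\min\{\int_\Omega|\nabla u|^2dx\,/\int_\Omega u^2dx : u\in H^1_0(\Omega),\ u\ne0\}$ is the first eigenvalue of the Dirichlet Laplacian; $T(\Omega)=\int_\Omega w_\Omega\,dx$ is the torsional rigidity, where $w_\Omega\in H^1_0(\Omega)$ is the unique weak solution of $-\Delta w=1$ in $\Omega$. For $q>0$, $$F_q(\Omega)=\frac{\lambda(\Omega)\,T(\Omega)^q}{|\Omega|^{(dq+2q-2)/d}}.$$ *)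

theory Defs
  imports "HOL-Analysis.Analysis"
begin

primrec Ck :: "nat \<Rightarrow> ('a::euclidean_space \<Rightarrow> real) \<Rightarrow> bool" where
  "Ck 0 f \<longleftrightarrow> continuous_on UNIV f"
| "Ck (Suc k) f \<longleftrightarrow>
     (\<forall>x. f differentiable (at x)) \<and>
     (\<forall>i\<in>Basis. Ck k (\<lambda>x. frechet_derivative f (at x) i))"

definition smooth :: "('a::euclidean_space \<Rightarrow> real) \<Rightarrow> bool" where
  "smooth f \<longleftrightarrow> (\<forall>k. Ck k f)"

definition grad :: "('a::euclidean_space \<Rightarrow> real) \<Rightarrow> 'a \<Rightarrow> 'a" where
  "grad f x = (\<Sum>i\<in>Basis. frechet_derivative f (at x) i *\<^sub>R i)"

text \<open>The space of smooth functions with compact support in \<open>\<Omega>\<close>; its elements are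
  represented by their extension by zero to the whole space.\<close>

definition test_functions :: "'a::euclidean_space set \<Rightarrow> ('a \<Rightarrow> real) set" where
  "test_functions \<Omega> =
     {\<phi>. smooth \<phi> \<and> compact (closure {x. \<phi> x \<noteq> 0}) \<and> closure {x. \<phi> x \<noteq> 0} \<subseteq> \<Omega>}"

text \<open>Elements of Lebesgue and Sobolev spaces are represented by functions rather than by
  classes modulo null sets, and their values outside \<open>\<Omega>\<close> are irrelevant.\<close>

definition L2 :: "'a::euclidean_space set \<Rightarrow> ('a \<Rightarrow> 'b::euclidean_space) set" where
  "L2 \<Omega> = {f. f \<in> borel_measurable (lebesgue_on \<Omega>) \<and>
                integrable (lebesgue_on \<Omega>) (\<lambda>x. (norm (f x))\<^sup>2)}"

definition is_weak_grad ::
    "'a::euclidean_space set \<Rightarrow> ('a \<Rightarrow> real) \<Rightarrow> ('a \<Rightarrow> 'a) \<Rightarrow> bool" where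
  "is_weak_grad \<Omega> u G \<longleftrightarrow>
     (\<forall>\<phi>\<in>test_functions \<Omega>.
        (\<integral>x. u x *\<^sub>R grad \<phi> x \<partial>lebesgue_on \<Omega>) = - (\<integral>x. \<phi> x *\<^sub>R G x \<partial>lebesgue_on \<Omega>))"

definition H1 :: "'a::euclidean_space set \<Rightarrow> ('a \<Rightarrow> real) set" where
  "H1 \<Omega> = {u \<in> L2 \<Omega>. \<exists>G\<in>L2 \<Omega>. is_weak_grad \<Omega> u G}"

text \<open>For open \<open>\<Omega>\<close> the weak gradient is unique up to null sets, so the choice does not
  affect any of the integrals below.\<close>

definition weak_grad :: "'a::euclidean_space set \<Rightarrow> ('a \<Rightarrow> real) \<Rightarrow> 'a \<Rightarrow> 'a" where
  "weak_grad \<Omega> u = (SOME G. G \<in> L2 \<Omega> \<and> is_weak_grad \<Omega> u G)"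

definition H1_norm :: "'a::euclidean_space set \<Rightarrow> ('a \<Rightarrow> real) \<Rightarrow> real" where
  "H1_norm \<Omega> u =
     sqrt ((\<integral>x. (u x)\<^sup>2 \<partial>lebesgue_on \<Omega>) + (\<integral>x. (norm (weak_grad \<Omega> u x))\<^sup>2 \<partial>lebesgue_on \<Omega>))"

text \<open>The closure of the test functions with respect to the \<open>H1\<close> norm.\<close>

definition H10 :: "'a::euclidean_space set \<Rightarrow> ('a \<Rightarrow> real) set" where
  "H10 \<Omega> = {u \<in> H1 \<Omega>. \<forall>\<epsilon>>0. \<exists>\<phi>\<in>test_functions \<Omega>. H1_norm \<Omega> (\<lambda>x. u x - \<phi> x) < \<epsilon>}"

text \<open>The infimum is a minimum whenever \<open>\<Omega>\<close> is open with finite positive measure.  The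
  condition \<open>u \<noteq> 0\<close> is understood in the space of classes modulo null sets.\<close>

definition dirichlet_eigenvalue :: "'a::euclidean_space set \<Rightarrow> real" where
  "dirichlet_eigenvalue \<Omega> =
     Inf {(\<integral>x. (norm (weak_grad \<Omega> u x))\<^sup>2 \<partial>lebesgue_on \<Omega>) / (\<integral>x. (u x)\<^sup>2 \<partial>lebesgue_on \<Omega>) | u.
          u \<in> H10 \<Omega> \<and> \<not> (AE x in lebesgue_on \<Omega>. u x = 0)}"

definition torsion_weak_solution :: "'a::euclidean_space set \<Rightarrow> ('a \<Rightarrow> real) \<Rightarrow> bool" where
  "torsion_weak_solution \<Omega> w \<longleftrightarrow>
     w \<in> H10 \<Omega> \<and>
     (\<forall>v\<in>H10 \<Omega>. (\<integral>x. weak_grad \<Omega> w x \<bullet> weak_grad \<Omega> v x \<partial>lebesgue_on \<Omega>)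
                    = (\<integral>x. v x \<partial>lebesgue_on \<Omega>))"

text \<open>The weak solution is unique only up to null sets, hence \<open>SOME\<close> and not \<open>THE\<close>.\<close>

definition torsion_function :: "'a::euclidean_space set \<Rightarrow> 'a \<Rightarrow> real" where
  "torsion_function \<Omega> = (SOME w. torsion_weak_solution \<Omega> w)"

definition torsional_rigidity :: "'a::euclidean_space set \<Rightarrow> real" where
  "torsional_rigidity \<Omega> = (\<integral>x. torsion_function \<Omega> x \<partial>lebesgue_on \<Omega>)"

definition F :: "real \<Rightarrow> 'a::euclidean_space set \<Rightarrow> real" where
  "F q \<Omega> =
     dirichlet_eigenvalue \<Omega> * torsional_rigidity \<Omega> powr q
       / measure lebesgue \<Omega> powr ((real DIM('a) * q + 2 * q - 2) / real DIM('a))"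

end

(*
  F q is not invariant under taking disjoint copies: for a union of N disjoint unit balls the
  eigenvalue stays the same, whereas torsional rigidity and volume are multiplied by N.  Hence
  F q grows like N powr (q - (d q + 2 q - 2) / d) = N powr (2 (1 - q) / d), which is unbounded.

  On such a union everything is explicit.  With c x the centre of the ball containing x, the field
  V x = (x - c x) / d is bounded and has divergence 1.  Integrating the divergence of V times the
  square of a test function gives a Poincare inequality, thus a lower bound for the eigenvalue that
  is independent of N.  Moreover - V is the gradient of w x = (1 - |x - c x|^2) / (2 d), so w is the
  torsion function, and no existence theorem for weak solutions is needed.
*)
theory Submission
  imports Defs
begin

subsection \<open>Calculus of smooth functions\<close>

text \<open>Two choices in the definitions shape the work. A weak gradient is picked by
  \<open>SOME\<close>, so nothing can be computed from it before its uniqueness up to null sets is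
  known; this is the fundamental lemma of the calculus of variations. And \<open>H10\<close> is a
  closure of test functions: inequalities and identities are proved for test functions and carried
  over by density, while membership of w in \<open>H10\<close> calls for explicit approximations.
  For these, w is composed with a smooth function that vanishes below 1/n, which moves the support
  away from the spheres.

  No boundary regularity enters. Everything is tested with functions compactly supported in the open
  balls, so integration by parts reduces to the vanishing integral of a partial derivative, and
  neither the jumps of V across the spheres nor the contact of neighbouring balls matters.

  Sharp constants are of no interest, only their dependence on N: the bound 1/d for V yields the
  eigenvalue bound d^2/4, and for the torsional rigidity a lower bound linear in N is
  enough.\<close>

lemma frechet_derivative_eqI:
  assumes "\<And>x. (f has_derivative f' x) (at x)"
  shows "frechet_derivative f (at x) = f' x"
  using frechet_derivative_at[OF assms] by simp

lemma Ck_SucI: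
  assumes "\<And>x. (f has_derivative f' x) (at x)" "\<And>i. i \<in> Basis \<Longrightarrow> Ck k (\<lambda>x. f' x i)"
  shows "Ck (Suc k) f"
  using assms unfolding Ck.simps frechet_derivative_eqI[OF assms(1)]
  by (auto simp: differentiable_def)

lemma Ck_Suc_has_derivative:
  assumes "Ck (Suc k) f"
  shows "(f has_derivative frechet_derivative f (at x)) (at x)"
  using assms frechet_derivative_works by auto

lemma Ck_SucD: "Ck (Suc k) f \<Longrightarrow> Ck k f"
proof (induction k arbitrary: f)
  case 0
  then show ?case
    by (auto intro!: continuous_at_imp_continuous_on differentiable_imp_continuous_within)
next
  case (Suc k)
  then show ?case by (subst Ck.simps) auto
qed

lemma Ck_const [simp]: "Ck k (\<lambda>x. c)"
proof (induction k arbitrary: c)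
  case (Suc k)
  show ?case by (rule Ck_SucI[where f' = "\<lambda>_ _. 0"]) (auto intro: Suc)
qed auto

lemma Ck_bounded_linear: "bounded_linear f \<Longrightarrow> Ck k f"
proof (cases k)
  case (Suc m)
  assume "bounded_linear f"
  then show ?thesis unfolding Suc
    by (intro Ck_SucI[where f' = "\<lambda>_. f"]) (auto intro: bounded_linear_imp_has_derivative)
qed (auto intro: linear_continuous_on)

lemma Ck_add: "Ck k f \<Longrightarrow> Ck k g \<Longrightarrow> Ck k (\<lambda>x. f x + g x)"
proof (induction k arbitrary: f g)
  case (Suc k)
  show ?case
    by (rule Ck_SucI[OF has_derivative_add[OF Ck_Suc_has_derivative[OF Suc.prems(1)]
          Ck_Suc_has_derivative[OF Suc.prems(2)]]])
      (use Suc in auto)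
qed (auto intro: continuous_intros)

lemma Ck_mult: "Ck k f \<Longrightarrow> Ck k g \<Longrightarrow> Ck k (\<lambda>x. f x * g x)"
proof (induction k arbitrary: f g)
  case (Suc k)
  show ?case
    by (rule Ck_SucI[OF has_derivative_mult[OF Ck_Suc_has_derivative[OF Suc.prems(1)]
          Ck_Suc_has_derivative[OF Suc.prems(2)]]])
      (use Suc Ck_SucD[OF Suc.prems(1)] Ck_SucD[OF Suc.prems(2)] in \<open>auto intro!: Ck_add\<close>)
qed (auto intro: continuous_intros)

lemma Ck_sum: "(\<And>i. i \<in> I \<Longrightarrow> Ck k (f i)) \<Longrightarrow> Ck k (\<lambda>x. \<Sum>i\<in>I. f i x)"
  by (induction I rule: infinite_finite_induct) (auto intro: Ck_add)

lemma Ck_prod: "(\<And>i. i \<in> I \<Longrightarrow> Ck k (f i)) \<Longrightarrow> Ck k (\<lambda>x. \<Prod>i\<in>I. f i x)"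
  by (induction I rule: infinite_finite_induct) (auto intro: Ck_mult)

text \<open>The outer function comes with all its derivatives as a sequence \<open>G\<close>, so
  that the induction on \<open>k\<close> can pass from index \<open>j\<close> to
  \<open>Suc j\<close>. For \<open>flat p\<close> the sequence is given by the iterates of
  \<open>flat_deriv\<close>.\<close>

lemma Ck_compose:
  assumes "\<And>j t. (G j has_real_derivative G (Suc j) t) (at t)" "Ck k f"
  shows "Ck k (\<lambda>x. G j (f x))"
  using assms(2)
proof (induction k arbitrary: j)
  case 0
  have "continuous_on UNIV (G j)"
    by (meson DERIV_isCont assms(1) continuous_at_imp_continuous_on)
  then show ?case using 0
    by (auto intro: continuous_on_compose2)
next
  case (Suc k)
  have "((\<lambda>x. G j (f x)) has_derivative (\<lambda>h. G (Suc j) (f x) * frechet_derivative f (at x) h)) (at x)" for x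
    by (rule has_derivative_compose[OF Ck_Suc_has_derivative[OF Suc.prems]
          assms(1)[unfolded has_field_derivative_def]])
  then show ?case
    by (rule Ck_SucI) (use Suc Ck_SucD[OF Suc.prems] in \<open>auto intro!: Ck_mult\<close>)
qed

lemma Ck_diff: "Ck k f \<Longrightarrow> Ck k g \<Longrightarrow> Ck k (\<lambda>x. f x - g x)"
  using Ck_add[of k f "\<lambda>x. (-1) * g x"] Ck_mult[OF Ck_const[of k "-1"], of g] by simp

text \<open>The derivative of a function of this form is again of this form, hence all of them are smooth.\<close>

definition flat :: "real poly \<Rightarrow> real \<Rightarrow> real" where
  "flat p s = (if s > 0 then poly p (1 / s) * exp (- 1 / s) else 0)"

abbreviation flat0 :: "real \<Rightarrow> real" where
  "flat0 \<equiv> flat 1"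

text \<open>The chain rule for p(1/s) exp(-1/s) yields (p(1/s) - p'(1/s)) / s^2 times the
  exponential; the factor \<open>[:0, 0, 1:]\<close> is the 1/s^2.\<close>

definition flat_deriv :: "real poly \<Rightarrow> real poly" where
  "flat_deriv p = [:0, 0, 1:] * (p - pderiv p)"

lemma poly_div_exp_tendsto_0: "((\<lambda>x. poly p x / exp x) \<longlongrightarrow> (0::real)) at_top"
proof -
  have "((\<lambda>x. \<Sum>i\<le>degree p. coeff p i * (x ^ i / exp x)) \<longlongrightarrow> (\<Sum>i\<le>degree p. coeff p i * 0)) at_top"
    by (intro tendsto_intros tendsto_power_div_exp_0)
  then show ?thesis
    by (simp add: poly_altdef sum_divide_distrib)
qed

lemma flat_has_derivative: "(flat p has_real_derivative flat (flat_deriv p) s) (at s)"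
proof -
  consider "s > 0" | "s < 0" | "s = 0" by linarith
  then show ?thesis
  proof cases
    case 1
    have "((\<lambda>s. poly p (1 / s) * exp (- 1 / s)) has_real_derivative
        poly (pderiv p) (1/s) * (- 1 / s^2) * exp (-1/s) + poly p (1/s) * (exp (-1/s) * (1 / s^2))) (at s)"
      by (rule derivative_eq_intros DERIV_chain2[OF poly_DERIV] refl | use 1 in \<open>simp add: power2_eq_square\<close>)+
    also have "poly (pderiv p) (1/s) * (- 1 / s^2) * exp (-1/s) + poly p (1/s) * (exp (-1/s) * (1 / s^2)) = flat (flat_deriv p) s"
      using 1 by (simp add: flat_def flat_deriv_def power2_eq_square field_simps)
    finally show ?thesis
      by (rule has_field_derivative_transform_within_open[where S = "{0<..}"])
        (use 1 in \<open>auto simp: flat_def\<close>)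
  next
    case 2
    have "((\<lambda>_. 0::real) has_real_derivative flat (flat_deriv p) s) (at s)"
      using 2 by (simp add: flat_def)
    then show ?thesis
      by (rule has_field_derivative_transform_within_open[where S = "{..<0}"])
        (use 2 in \<open>auto simp: flat_def\<close>)
  next
    case 3
    \<comment> \<open>The right difference quotient at 0 is p(1/h) exp(-1/h) / h; the additional 1/h
      is absorbed by multiplying the polynomial by its variable, which is
      \<open>pCons 0 p\<close>.\<close>
    have "((\<lambda>h. poly (pCons 0 p) (inverse h) / exp (inverse h)) \<longlongrightarrow> 0) (at_right (0::real))"
      by (rule filterlim_compose[OF poly_div_exp_tendsto_0 filterlim_inverse_at_top_right])
    then have "((\<lambda>h. flat p h / h) \<longlongrightarrow> 0) (at_right 0)"
      by (rule Lim_transform_eventually)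
        (auto simp: eventually_at_filter flat_def exp_minus field_simps intro!: always_eventually)
    moreover have "((\<lambda>h. flat p h / h) \<longlongrightarrow> 0) (at_left 0)"
      by (rule Lim_transform_eventually[OF tendsto_const])
        (auto simp: eventually_at_filter flat_def intro!: always_eventually)
    ultimately have "((\<lambda>h. flat p h / h) \<longlongrightarrow> 0) (at 0)"
      using filterlim_split_at by blast
    then show ?thesis using 3
      by (simp add: has_field_derivative_iff flat_def)
  qed
qed

lemma Ck_flat: "Ck k f \<Longrightarrow> Ck k (\<lambda>x. flat p (f x))"
  using Ck_compose[of "\<lambda>j. flat ((flat_deriv ^^ j) p)" k f 0] flat_has_derivative by simp

lemma flat0_nonneg: "0 \<le> flat0 s" and flat0_le_1: "flat0 s \<le> 1"
  and flat0_nonpos: "s \<le> 0 \<Longrightarrow> flat0 s = 0"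
  by (auto simp: flat_def)

text \<open>As the argument t grows, 1/t tends to 0, so the exponential factor tends to 1 and only
  the constant term of \<open>p\<close> survives. For \<open>s \<le> 0\<close> the argument never
  becomes positive, which is where \<open>c \<ge> 0\<close> enters. The shift 0 serves
  \<open>smooth_box\<close>, the shift 1 serves \<open>cutoff\<close>.\<close>

lemma flat_scaled_tendsto:
  assumes "c \<ge> 0"
  shows "(\<lambda>n. flat p (real n * s - c)) \<longlonglongrightarrow> (if s > 0 then poly p 0 else 0)"
proof (cases "s > 0")
  case True
  have "filterlim (\<lambda>n. - c + real n * s) at_top sequentially"
    by (intro filterlim_tendsto_add_at_top[OF tendsto_const]
        filterlim_at_top_mult_tendsto_pos[OF tendsto_const True] filterlim_real_sequentially)
  then have l: "filterlim (\<lambda>n. real n * s - c) at_top sequentially" by simp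
  have "((\<lambda>t. poly p (inverse t) * exp (- inverse t)) \<longlongrightarrow> poly p 0 * exp (- (0::real))) at_top"
    by (intro tendsto_intros tendsto_inverse_0_at_top filterlim_ident)
  then have "((\<lambda>t. poly p (inverse t) * exp (- inverse t)) \<longlongrightarrow> poly p 0) at_top"
    by simp
  then have "(flat p \<longlongrightarrow> poly p 0) at_top"
    by (rule Lim_transform_eventually)
      (use eventually_gt_at_top[of 0] in \<open>eventually_elim, auto simp: flat_def divide_inverse\<close>)
  from filterlim_compose[OF this l] show ?thesis using True by simp
next
  case False
  have "flat p (real n * s - c) = 0" for n
    using False assms mult_nonneg_nonpos[of "real n" s] by (simp add: flat_def)
  then show ?thesis using False by simp
qed

text \<open>A smooth substitute for the identity that vanishes for \<open>t \<le> 1 / n\<close> and has slope in \<open>[0, 1]\<close>.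
  For \<open>n = 0\<close> it is zero, since \<open>1 / 0 = 0\<close> and \<open>flat0 (- 1) = 0\<close>.\<close>

definition cutoff :: "nat \<Rightarrow> real \<Rightarrow> real" where
  "cutoff n t = (t - 1 / real n) * flat0 (real n * t - 1)"

text \<open>For n > 0 and \<open>s = real n * t - 1\<close> the function is
  \<open>s * flat0 s / real n\<close>, and s exp(-1/s) has derivative (1 + 1/s) exp(-1/s), whose
  polynomial in 1/s is \<open>[:1, 1:]\<close>.\<close>

lemma cutoff_derivative:
  "(cutoff n has_real_derivative flat [:1, 1:] (real n * t - 1)) (at t)"
proof (cases "n = 0")
  case True
  have "cutoff n = (\<lambda>_. 0)" by (simp add: cutoff_def[abs_def] flat0_nonpos True)
  then show ?thesis by (simp add: True flat_def)
next
  case False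
  note d = DERIV_chain2[OF flat_has_derivative, of "\<lambda>t. real n * t - 1" "real n" t]
  have "(cutoff n has_real_derivative flat0 (real n * t - 1) +
      (t - 1 / real n) * (flat (flat_deriv 1) (real n * t - 1) * real n)) (at t)"
    unfolding cutoff_def[abs_def]
    by (rule derivative_eq_intros d refl | simp)+
  also have "flat0 (real n * t - 1) + (t - 1 / real n) * (flat (flat_deriv 1) (real n * t - 1) * real n)
      = flat [:1, 1:] (real n * t - 1)"
  proof -
    have "(t - 1 / real n) * real n = real n * t - 1" using False by (simp add: field_simps)
    then have e1: "(t - 1 / real n) * (flat (flat_deriv 1) (real n * t - 1) * real n) =
        (real n * t - 1) * flat (flat_deriv 1) (real n * t - 1)"
      by (metis mult.assoc mult.commute)
    have e2: "flat0 s + s * flat (flat_deriv 1) s = flat [:1, 1:] s" for s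
      by (simp add: flat_def flat_deriv_def field_simps)
    show ?thesis by (simp only: e1 e2)
  qed
  finally show ?thesis .
qed

text \<open>The upper bound is 1 + y \<le> exp y at y = 1/s. It ensures that composition with
  \<open>cutoff\<close> never lengthens a gradient.\<close>

lemma flat_slope_bounds: "0 \<le> flat [:1, 1:] s" "flat [:1, 1:] s \<le> 1"
proof -
  show "0 \<le> flat [:1, 1:] s" by (simp add: flat_def)
  have "(1 + 1 / s) * exp (- (1 / s)) \<le> exp (1 / s) * exp (- (1 / s))"
    by (rule mult_right_mono[OF exp_ge_add_one_self]) simp
  then show "flat [:1, 1:] s \<le> 1" by (simp add: flat_def exp_minus)
qed

lemma cutoff_bounds:
  assumes "0 \<le> t"
  shows "0 \<le> cutoff n t" "cutoff n t \<le> t"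
proof -
  consider "real n * t - 1 \<le> 0" | "real n * t - 1 > 0" by linarith
  then have "0 \<le> cutoff n t \<and> cutoff n t \<le> t"
  proof cases
    case 1
    then show ?thesis using assms by (simp add: cutoff_def flat0_nonpos)
  next
    case 2
    then have "0 < real n" by (cases n) auto
    with 2 have "0 \<le> t - 1 / real n" by (simp add: field_simps)
    then show ?thesis
      using mult_left_mono[OF flat0_le_1, of "t - 1 / real n" "real n * t - 1"] flat0_nonneg[of "real n * t - 1"]
      by (simp add: cutoff_def) (rule order_trans[where y = "t - 1 / real n"], auto)
  qed
  then show "0 \<le> cutoff n t" "cutoff n t \<le> t" by auto
qed

lemma cutoff_tendsto:
  assumes "0 < t"
  shows "(\<lambda>n. cutoff n t) \<longlonglongrightarrow> t"
proof -
  have "(\<lambda>n. (t - 1 / real n) * flat0 (real n * t - 1)) \<longlonglongrightarrow> (t - 0) * 1"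
    using flat_scaled_tendsto[of 1 1 t] assms by (intro tendsto_intros lim_1_over_n) simp
  then show ?thesis by (simp add: cutoff_def)
qed

subsection \<open>Integration by parts\<close>

text \<open>By translation invariance the difference quotients in direction \<open>i\<close> have integral zero.\<close>

lemma partial_derivative_integral_zero:
  fixes f :: "'a::euclidean_space \<Rightarrow> real"
  assumes der: "\<And>x. (f has_derivative f' x) (at x)"
    and bound: "\<And>x. \<bar>f' x i\<bar> \<le> B" and i: "i \<in> Basis"
    and supp: "\<And>x. f x \<noteq> 0 \<Longrightarrow> norm x \<le> R"
  shows "integrable lebesgue (\<lambda>x. f' x i)" "(\<integral>x. f' x i \<partial>lebesgue) = 0"
proof -
  define h where "h n = 1 / real (Suc n)" for n
  have h: "0 < h n" "h n \<le> 1" for n by (auto simp: h_def)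
  have h0: "h \<longlonglongrightarrow> 0" unfolding h_def using LIMSEQ_inverse_real_of_nat
    by (simp add: inverse_eq_divide)
  define q where "q n x = (f (x + h n *\<^sub>R i) - f x) / h n" for n x
  have contf: "continuous_on UNIV f"
    using der by (meson continuous_at_imp_continuous_on has_derivative_continuous)
  have fm [measurable]: "f \<in> borel_measurable borel"
    using contf by (rule borel_measurable_continuous_onI)
  have line: "((\<lambda>t. f (x + t *\<^sub>R i)) has_real_derivative f' (x + t *\<^sub>R i) i) (at t)" for x t
  proof -
    have "((\<lambda>t. x + t *\<^sub>R i) has_derivative (\<lambda>s. s *\<^sub>R i)) (at t)"
      by (auto intro!: derivative_eq_intros)
    from has_derivative_compose[OF this der]
    have "((\<lambda>t. f (x + t *\<^sub>R i)) has_derivative (\<lambda>s. f' (x + t *\<^sub>R i) (s *\<^sub>R i))) (at t)" .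
    moreover have "linear (f' (x + t *\<^sub>R i))"
      using der has_derivative_linear by blast
    ultimately show ?thesis
      by (simp add: has_field_derivative_def linear_scale mult.commute[of _ "f' _ i"])
  qed
  have lim: "(\<lambda>n. q n x) \<longlonglongrightarrow> f' x i" for x
  proof -
    have "((\<lambda>t. (f (x + t *\<^sub>R i) - f x) / t) \<longlongrightarrow> f' x i) (at 0)"
      using line[of x 0] by (simp add: has_field_derivative_iff)
    moreover have "filterlim h (at 0) sequentially"
      using h0 h by (auto simp: filterlim_at intro!: always_eventually less_imp_neq[THEN not_sym])
    ultimately show ?thesis
      unfolding q_def by (rule filterlim_compose)
  qed
  \<comment> \<open>The mean value inequality along the line bounds the quotients independently of
    \<open>n\<close>, as dominated convergence requires.\<close>
  have qb: "\<bar>q n x\<bar> \<le> B" for n x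
  proof -
    have "norm (f (x + h n *\<^sub>R i) - f (x + 0 *\<^sub>R i)) \<le> B * norm (h n - 0)"
      by (rule field_differentiable_bound[OF convex_UNIV, where f' = "\<lambda>t. f' (x + t *\<^sub>R i) i"])
        (use line bound in auto)
    then show ?thesis
      using h[of n] by (simp add: q_def field_simps abs_mult)
  qed
  have fi: "integrable lborel f"
  proof -
    have "integrable lborel (\<lambda>x. indicator (cball 0 R) x *\<^sub>R f x)"
      by (rule borel_integrable_compact) (use contf in \<open>auto intro: continuous_on_subset\<close>)
    also have "(\<lambda>x. indicator (cball 0 R) x *\<^sub>R f x) = f"
      using supp by (auto simp: indicator_def fun_eq_iff)
    finally show ?thesis .
  qed
  have shift: "integrable lborel (\<lambda>x. f (x + c))" "(\<integral>x. f (x + c) \<partial>lborel) = (\<integral>x. f x \<partial>lborel)" for c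
  proof -
    have "integrable (distr lborel borel ((+) c)) f" unfolding lborel_distr_plus by (rule fi)
    then show "integrable lborel (\<lambda>x. f (x + c))"
      by (subst (asm) integrable_distr_eq) (auto simp: add.commute)
    have "(\<integral>x. f x \<partial>lborel) = (\<integral>x. f x \<partial>distr lborel borel ((+) c))" unfolding lborel_distr_plus ..
    then show "(\<integral>x. f (x + c) \<partial>lborel) = (\<integral>x. f x \<partial>lborel)"
      by (subst (asm) integral_distr) (auto simp: add.commute)
  qed
  have q0: "(\<integral>x. q n x \<partial>lborel) = 0" for n
    unfolding q_def using shift fi by simp
  \<comment> \<open>The derivative is not assumed to be continuous; it is measurable as a pointwise
    limit of difference quotients.\<close>
  have fm': "(\<lambda>x. f' x i) \<in> borel_measurable borel"
    by (rule borel_measurable_LIMSEQ_real[OF lim]) (auto simp: q_def)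
  \<comment> \<open>The steps \<open>h n\<close> are at most 1, so all quotients vanish outside the
    ball of radius \<open>R + 1\<close>.\<close>
  have bnd: "AE x in lborel. norm (q n x) \<le> B * indicator (cball 0 (R + 1)) x" for n
  proof (rule AE_I2)
    fix x
    show "norm (q n x) \<le> B * indicator (cball 0 (R + 1)) x"
    proof (cases "norm x \<le> R + 1")
      case True then show ?thesis using qb by simp
    next
      case False
      have "norm x - norm (h n *\<^sub>R i) \<le> norm (x + h n *\<^sub>R i)"
        using norm_triangle_ineq4[of "x + h n *\<^sub>R i" "h n *\<^sub>R i"] by simp
      then have "R < norm (x + h n *\<^sub>R i)"
        using False h[of n] i by simp
      then have "f (x + h n *\<^sub>R i) = 0" "f x = 0" using supp False by force+
      then show ?thesis by (simp add: q_def False)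
    qed
  qed
  have int: "integrable lborel (\<lambda>x. B * indicator (cball (0::'a) (R + 1)) x)"
    using emeasure_lborel_cball_finite[of "0::'a" "R+1"] 
    by (intro integrable_mult_right integrable_real_indicator) auto
  have mq: "q n \<in> borel_measurable lborel" for n unfolding q_def by measurable
  have i1: "integrable lborel (\<lambda>x. f' x i)"
    by (rule integrable_dominated_convergence[OF _ mq int AE_I2[OF lim] bnd]) (use fm' in simp)
  have "(\<lambda>n. \<integral>x. q n x \<partial>lborel) \<longlonglongrightarrow> (\<integral>x. f' x i \<partial>lborel)"
    by (rule integral_dominated_convergence[OF _ mq int AE_I2[OF lim] bnd]) (use fm' in simp)
  then have i2: "(\<integral>x. f' x i \<partial>lborel) = 0"
    unfolding q0 by (simp add: LIMSEQ_const_iff)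
  show "integrable lebesgue (\<lambda>x. f' x i)" using i1 fm' by (simp add: integrable_completion)
  show "(\<integral>x. f' x i \<partial>lebesgue) = 0" using i2 fm' by (simp add: integral_completion)
qed

subsection \<open>Square-integrable functions\<close>

definition L2_norm :: "'a::euclidean_space set \<Rightarrow> ('a \<Rightarrow> 'b::euclidean_space) \<Rightarrow> real" where
  "L2_norm \<Omega> f = sqrt (\<integral>x. (norm (f x))\<^sup>2 \<partial>lebesgue_on \<Omega>)"

lemma L2_measurable: "f \<in> L2 \<Omega> \<Longrightarrow> f \<in> borel_measurable (lebesgue_on \<Omega>)"
  and L2_integrable: "f \<in> L2 \<Omega> \<Longrightarrow> integrable (lebesgue_on \<Omega>) (\<lambda>x. (norm (f x))\<^sup>2)"
  and L2I: "f \<in> borel_measurable (lebesgue_on \<Omega>) \<Longrightarrow> integrable (lebesgue_on \<Omega>) (\<lambda>x. (norm (f x))\<^sup>2) \<Longrightarrow> f \<in> L2 \<Omega>"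
  by (auto simp: L2_def)

lemma L2_norm_nonneg [simp]: "0 \<le> L2_norm \<Omega> f"
  by (simp add: L2_norm_def)

lemma L2_norm_power2: "(L2_norm \<Omega> f)\<^sup>2 = (\<integral>x. (norm (f x))\<^sup>2 \<partial>lebesgue_on \<Omega>)"
  by (simp add: L2_norm_def)

lemma L2_product_integrable:
  assumes "f \<in> L2 \<Omega>" "g \<in> L2 \<Omega>"
  shows "integrable (lebesgue_on \<Omega>) (\<lambda>x. norm (f x) * norm (g x))"
proof (rule Bochner_Integration.integrable_bound)
  show "integrable (lebesgue_on \<Omega>) (\<lambda>x. (norm (f x))\<^sup>2 + (norm (g x))\<^sup>2)"
    using assms by (intro Bochner_Integration.integrable_add L2_integrable)
  show "(\<lambda>x. norm (f x) * norm (g x)) \<in> borel_measurable (lebesgue_on \<Omega>)"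
    using assms[THEN L2_measurable] by measurable
  have "norm (norm (f x) * norm (g x)) \<le> norm ((norm (f x))\<^sup>2 + (norm (g x))\<^sup>2)" for x
  proof -
    have half: "c \<le> d" if "0 \<le> c" "2 * c \<le> d" for c d :: real
      using that by linarith
    have "norm (f x) * norm (g x) \<le> (norm (f x))\<^sup>2 + (norm (g x))\<^sup>2"
      by (rule half) (use sum_squares_bound[of "norm (f x)" "norm (g x)"] in \<open>simp_all add: mult.assoc\<close>)
    then show ?thesis by simp
  qed
  then show "AE x in lebesgue_on \<Omega>. norm (norm (f x) * norm (g x)) \<le> norm ((norm (f x))\<^sup>2 + (norm (g x))\<^sup>2)"
    by simp
qed

text \<open>The integral of (t |f| - |g|)^2 is a nonnegative quadratic in t. Its value at the
  minimum \<open>t = C / A\<close> gives the bound; if \<open>A = 0\<close>, it is affine and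
  nonnegative, hence constant.\<close>

lemma L2_Cauchy_Schwarz:
  assumes f: "f \<in> L2 \<Omega>" and g: "g \<in> L2 \<Omega>"
  shows "(\<integral>x. norm (f x) * norm (g x) \<partial>lebesgue_on \<Omega>) \<le> L2_norm \<Omega> f * L2_norm \<Omega> g"
proof -
  note I = L2_integrable[OF f] L2_integrable[OF g] L2_product_integrable[OF f g]
  define A where "A = (\<integral>x. (norm (f x))\<^sup>2 \<partial>lebesgue_on \<Omega>)"
  define B where "B = (\<integral>x. (norm (g x))\<^sup>2 \<partial>lebesgue_on \<Omega>)"
  define C where "C = (\<integral>x. norm (f x) * norm (g x) \<partial>lebesgue_on \<Omega>)"
  have A0: "A \<ge> 0" and B0: "B \<ge> 0" by (auto simp: A_def B_def)
  have key: "0 \<le> t\<^sup>2 * A - 2 * t * C + B" for t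
  proof -
    have "0 \<le> (\<integral>x. (t * norm (f x) - norm (g x))\<^sup>2 \<partial>lebesgue_on \<Omega>)" by simp
    also have "\<dots> = (\<integral>x. t\<^sup>2 * (norm (f x))\<^sup>2 - (2 * t) * (norm (f x) * norm (g x)) + (norm (g x))\<^sup>2 \<partial>lebesgue_on \<Omega>)"
      by (intro Bochner_Integration.integral_cong refl) (simp add: power2_eq_square algebra_simps)
    also have "\<dots> = t\<^sup>2 * A - 2 * t * C + B"
      using I by (simp add: A_def B_def C_def)
    finally show ?thesis .
  qed
  have "C\<^sup>2 \<le> A * B"
  proof (cases "A = 0")
    case True
    have "C = 0"
    proof (rule ccontr)
      assume "C \<noteq> 0"
      \<comment> \<open>At this argument the affine function \<open>B - 2 * t * C\<close> equals
        -1.\<close>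
      then show False using key[of "(B + 1) / (2 * C)"] True by (simp add: field_simps)
    qed
    then show ?thesis using True by simp
  next
    case False
    then have "0 < A" using A0 by simp
    then show ?thesis using key[of "C / A"]
      by (simp add: power2_eq_square field_simps)
  qed
  then have "C \<le> sqrt (A * B)"
    by (rule real_le_rsqrt)
  then show ?thesis
    by (simp add: L2_norm_def A_def B_def C_def real_sqrt_mult)
qed

text \<open>One statement for all products that occur: scalar times vector, inner product, product
  with the constant 1. They share nothing but the pointwise bound on norms.\<close>

lemma L2_bilinear_bound:
  fixes f :: "'a::euclidean_space \<Rightarrow> 'b::euclidean_space" and g :: "'a \<Rightarrow> 'c::euclidean_space"
    and h :: "'a \<Rightarrow> 'd::euclidean_space"
  assumes f: "f \<in> L2 \<Omega>" and g: "g \<in> L2 \<Omega>"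
    and h: "h \<in> borel_measurable (lebesgue_on \<Omega>)"
    and le: "\<And>x. norm (h x) \<le> norm (f x) * norm (g x)"
  shows "integrable (lebesgue_on \<Omega>) h"
    and "norm (\<integral>x. h x \<partial>lebesgue_on \<Omega>) \<le> L2_norm \<Omega> f * L2_norm \<Omega> g"
proof -
  note I = L2_product_integrable[OF f g]
  show hi: "integrable (lebesgue_on \<Omega>) h"
    by (rule Bochner_Integration.integrable_bound[OF I h]) (use le in auto)
  have "norm (\<integral>x. h x \<partial>lebesgue_on \<Omega>) \<le> (\<integral>x. norm (f x) * norm (g x) \<partial>lebesgue_on \<Omega>)"
    using I le by (intro Bochner_Integration.integral_norm_bound_integral[OF hi]) auto
  also have "\<dots> \<le> L2_norm \<Omega> f * L2_norm \<Omega> g"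
    by (rule L2_Cauchy_Schwarz[OF f g])
  finally show "norm (\<integral>x. h x \<partial>lebesgue_on \<Omega>) \<le> L2_norm \<Omega> f * L2_norm \<Omega> g" .
qed

lemma L2_add_triangle:
  assumes f: "f \<in> L2 \<Omega>" and g: "g \<in> L2 \<Omega>"
  shows "(\<lambda>x. f x + g x) \<in> L2 \<Omega>"
    and "L2_norm \<Omega> (\<lambda>x. f x + g x) \<le> L2_norm \<Omega> f + L2_norm \<Omega> g"
proof -
  let ?b = "\<lambda>x. (norm (f x))\<^sup>2 + 2 * (norm (f x) * norm (g x)) + (norm (g x))\<^sup>2"
  note I = L2_integrable[OF f] L2_integrable[OF g] L2_product_integrable[OF f g]
  have le: "(norm (f x + g x))\<^sup>2 \<le> ?b x" for x
    using power_mono[OF norm_triangle_ineq[of "f x" "g x"], of 2]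
    by (simp add: power2_eq_square algebra_simps)
  have bi: "integrable (lebesgue_on \<Omega>) ?b" using I by simp
  have m: "(\<lambda>x. f x + g x) \<in> borel_measurable (lebesgue_on \<Omega>)" using L2_measurable[OF f] L2_measurable[OF g] by measurable
  have i: "integrable (lebesgue_on \<Omega>) (\<lambda>x. (norm (f x + g x))\<^sup>2)"
  proof (rule Bochner_Integration.integrable_bound[OF bi])
    show "(\<lambda>x. (norm (f x + g x))\<^sup>2) \<in> borel_measurable (lebesgue_on \<Omega>)"
      using m by measurable
    have "norm ((norm (f x + g x))\<^sup>2) \<le> norm (?b x)" for x
      using le[of x] by simp
    then show "AE x in lebesgue_on \<Omega>. norm ((norm (f x + g x))\<^sup>2) \<le> norm (?b x)" by simp
  qed
  show "(\<lambda>x. f x + g x) \<in> L2 \<Omega>" using m i by (rule L2I)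
  have "(\<integral>x. (norm (f x + g x))\<^sup>2 \<partial>lebesgue_on \<Omega>) \<le> (\<integral>x. ?b x \<partial>lebesgue_on \<Omega>)"
    using le by (intro Bochner_Integration.integral_mono i bi)
  also have "\<dots> = (L2_norm \<Omega> f)\<^sup>2 + 2 * (\<integral>x. norm (f x) * norm (g x) \<partial>lebesgue_on \<Omega>) + (L2_norm \<Omega> g)\<^sup>2"
    using I by (simp add: L2_norm_power2)
  also have "\<dots> \<le> (L2_norm \<Omega> f + L2_norm \<Omega> g)\<^sup>2"
    using L2_Cauchy_Schwarz[OF f g] by (simp add: power2_eq_square algebra_simps)
  finally show "L2_norm \<Omega> (\<lambda>x. f x + g x) \<le> L2_norm \<Omega> f + L2_norm \<Omega> g"
    unfolding L2_norm_def[of _ "\<lambda>x. f x + g x"] by (rule real_le_lsqrt[rotated 1]) auto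
qed

lemma L2_minus:
  assumes "f \<in> L2 \<Omega>"
  shows "(\<lambda>x. - f x) \<in> L2 \<Omega>" "L2_norm \<Omega> (\<lambda>x. - f x) = L2_norm \<Omega> f"
  using L2I[of "\<lambda>x. - f x" \<Omega>] L2_integrable[OF assms] L2_measurable[OF assms]
  by (auto simp: L2_norm_def)

lemma L2_diff_triangle:
  assumes f: "f \<in> L2 \<Omega>" and g: "g \<in> L2 \<Omega>"
  shows "(\<lambda>x. f x - g x) \<in> L2 \<Omega>"
    and "L2_norm \<Omega> (\<lambda>x. f x - g x) \<le> L2_norm \<Omega> f + L2_norm \<Omega> g"
    and "L2_norm \<Omega> f \<le> L2_norm \<Omega> g + L2_norm \<Omega> (\<lambda>x. f x - g x)"
proof -
  show d: "(\<lambda>x. f x - g x) \<in> L2 \<Omega>"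
    using L2_add_triangle(1)[OF f L2_minus(1)[OF g]] by simp
  show "L2_norm \<Omega> (\<lambda>x. f x - g x) \<le> L2_norm \<Omega> f + L2_norm \<Omega> g"
    using L2_add_triangle(2)[OF f L2_minus(1)[OF g]] L2_minus(2)[OF g] by simp
  show "L2_norm \<Omega> f \<le> L2_norm \<Omega> g + L2_norm \<Omega> (\<lambda>x. f x - g x)"
    using L2_add_triangle(2)[OF g d] by simp
qed

lemma L2_norm_cong_AE:
  assumes "f \<in> L2 \<Omega>" "g \<in> L2 \<Omega>" "AE x in lebesgue_on \<Omega>. f x = g x"
  shows "L2_norm \<Omega> f = L2_norm \<Omega> g"
  unfolding L2_norm_def using assms
  by (intro arg_cong[where f = sqrt] integral_cong_AE) (auto simp: L2_def)

lemma L2_norm_tendsto_0: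
  fixes f :: "nat \<Rightarrow> 'a::euclidean_space \<Rightarrow> 'b::euclidean_space"
  assumes \<Omega>: "\<Omega> \<in> lmeasurable"
    and m: "\<And>n. f n \<in> L2 \<Omega>"
    and b: "\<And>n x. x \<in> \<Omega> \<Longrightarrow> norm (f n x) \<le> 1"
    and lim: "\<And>x. x \<in> \<Omega> \<Longrightarrow> (\<lambda>n. f n x) \<longlonglongrightarrow> 0"
  shows "(\<lambda>n. L2_norm \<Omega> (f n)) \<longlonglongrightarrow> 0"
proof -
  interpret finite_measure "lebesgue_on \<Omega>"
    by (rule finite_measure_lebesgue_on[OF \<Omega>])
  have "(\<lambda>n. \<integral>x. (norm (f n x))\<^sup>2 \<partial>lebesgue_on \<Omega>) \<longlonglongrightarrow> (\<integral>x. 0 \<partial>lebesgue_on \<Omega>)"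
  proof (rule integral_dominated_convergence[where w = "\<lambda>_. 1"])
    show "(\<lambda>x. (norm (f n x))\<^sup>2) \<in> borel_measurable (lebesgue_on \<Omega>)" for n
      using L2_integrable[OF m] by (rule borel_measurable_integrable)
    have "(\<lambda>n. (norm (f n x))\<^sup>2) \<longlonglongrightarrow> (norm (0::'b))\<^sup>2" if "x \<in> \<Omega>" for x
      by (intro tendsto_intros lim that)
    then show "AE x in lebesgue_on \<Omega>. (\<lambda>n. (norm (f n x))\<^sup>2) \<longlonglongrightarrow> 0"
      by (intro AE_I2) simp
    show "AE x in lebesgue_on \<Omega>. norm ((norm (f n x))\<^sup>2) \<le> 1" for n
      using b by (intro AE_I2) (simp add: power_le_one)
  qed auto
  then have "(\<lambda>n. sqrt (\<integral>x. (norm (f n x))\<^sup>2 \<partial>lebesgue_on \<Omega>)) \<longlonglongrightarrow> sqrt 0"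
    by (intro tendsto_real_sqrt) simp
  then show ?thesis by (simp add: L2_norm_def)
qed

subsection \<open>Test functions\<close>

lemma Ck_continuous: "Ck k f \<Longrightarrow> continuous_on UNIV f"
proof (induction k)
  case (Suc k)
  then show ?case using Ck_SucD by blast
qed simp

lemma test_function_Ck: "\<phi> \<in> test_functions \<Omega> \<Longrightarrow> Ck k \<phi>"
  by (simp add: test_functions_def smooth_def)

lemma test_function_support: "\<phi> \<in> test_functions \<Omega> \<Longrightarrow> compact (closure {x. \<phi> x \<noteq> 0})"
  by (simp add: test_functions_def)

lemma has_derivative_grad:
  assumes "Ck (Suc k) f"
  shows "(f has_derivative (\<lambda>v. grad f x \<bullet> v)) (at x)"
proof -
  have d: "(f has_derivative frechet_derivative f (at x)) (at x)"
    using assms by (rule Ck_Suc_has_derivative)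
  have "frechet_derivative f (at x) v = grad f x \<bullet> v" for v
  proof -
    have l: "linear (frechet_derivative f (at x))"
      using d has_derivative_linear by blast
    have "frechet_derivative f (at x) v = frechet_derivative f (at x) (\<Sum>i\<in>Basis. (v \<bullet> i) *\<^sub>R i)"
      by (simp add: euclidean_representation)
    also have "\<dots> = grad f x \<bullet> v"
      using l by (simp add: linear_sum linear_scale grad_def inner_sum_left inner_sum_right inner_commute mult.commute)
    finally show ?thesis .
  qed
  then show ?thesis using d by (metis (no_types, lifting) ext)
qed

lemma grad_eqI:
  assumes "(f has_derivative (\<lambda>v. g \<bullet> v)) (at x)"
  shows "grad f x = g"
proof -
  have "frechet_derivative f (at x) = (\<lambda>v. g \<bullet> v)"
    using frechet_derivative_at[OF assms] by simp
  then show ?thesis by (simp add: grad_def euclidean_representation)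
qed

lemma continuous_grad:
  assumes "Ck (Suc k) f"
  shows "continuous_on UNIV (grad f)"
proof -
  have "continuous_on UNIV (\<lambda>x. frechet_derivative f (at x) i)" if "i \<in> Basis" for i
  proof -
    have "Ck k (\<lambda>x. frechet_derivative f (at x) i)" using assms that by simp
    then show ?thesis by (rule Ck_continuous)
  qed
  then show ?thesis
    unfolding grad_def[abs_def] by (intro continuous_intros)
qed

lemma test_function_zero:
  assumes "\<phi> \<in> test_functions \<Omega>" "x \<notin> closure {x. \<phi> x \<noteq> 0}"
  shows "\<phi> x = 0" "grad \<phi> x = 0"
proof -
  note sub = closure_subset[of "{x. \<phi> x \<noteq> 0}"]
  show "\<phi> x = 0" using assms(2) sub by auto
  have "((\<lambda>_. 0) has_derivative (\<lambda>v. 0 \<bullet> v)) (at x)" by simp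
  then have "(\<phi> has_derivative (\<lambda>v. 0 \<bullet> v)) (at x)"
    by (rule has_derivative_transform_within_open[where s = "- closure {x. \<phi> x \<noteq> 0}"])
      (use assms(2) sub in auto)
  then show "grad \<phi> x = 0" by (rule grad_eqI)
qed

lemma test_function_zero_outside:
  assumes "\<phi> \<in> test_functions \<Omega>" "x \<notin> \<Omega>"
  shows "\<phi> x = 0" "grad \<phi> x = 0"
proof -
  have "x \<notin> closure {x. \<phi> x \<noteq> 0}" using assms by (auto simp: test_functions_def)
  from test_function_zero[OF assms(1) this] show "\<phi> x = 0" "grad \<phi> x = 0" by blast+
qed

lemma test_functionI:
  assumes "\<And>k. Ck k \<phi>" "compact K" "K \<subseteq> \<Omega>" "\<And>x. x \<notin> K \<Longrightarrow> \<phi> x = 0"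
  shows "\<phi> \<in> test_functions \<Omega>"
proof -
  have sub: "{x. \<phi> x \<noteq> 0} \<subseteq> K" using assms(4) by auto
  have "closure {x. \<phi> x \<noteq> 0} \<subseteq> K"
    using closure_minimal[OF sub compact_imp_closed[OF assms(2)]] .
  moreover have "compact (closure {x. \<phi> x \<noteq> 0})"
    unfolding compact_closure using bounded_subset[OF compact_imp_bounded[OF assms(2)] sub] .
  ultimately show ?thesis
    using assms(1,3) by (simp add: test_functions_def smooth_def)
qed

lemma test_function_mult:
  assumes "\<And>k. Ck k f" "\<phi> \<in> test_functions \<Omega>"
  shows "(\<lambda>x. f x * \<phi> x) \<in> test_functions \<Omega>"
proof (rule test_functionI[OF _ test_function_support[OF assms(2)]])
  show "closure {x. \<phi> x \<noteq> 0} \<subseteq> \<Omega>" using assms(2) by (simp add: test_functions_def)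
  show "Ck k (\<lambda>x. f x * \<phi> x)" for k by (rule Ck_mult[OF assms(1) test_function_Ck[OF assms(2)]])
  show "f x * \<phi> x = 0" if "x \<notin> closure {x. \<phi> x \<noteq> 0}" for x
    using test_function_zero(1)[OF assms(2) that] by simp
qed

lemma continuous_compact_support_bounded:
  fixes g :: "'a::euclidean_space \<Rightarrow> 'b::euclidean_space"
  assumes "continuous_on UNIV g" "compact K" "\<And>x. x \<notin> K \<Longrightarrow> g x = 0"
  shows "\<exists>B>0. \<forall>x. norm (g x) \<le> B"
proof -
  have "compact (g ` K)"
    using assms compact_continuous_image continuous_on_subset by blast
  then obtain B where "B > 0" "\<And>x. x \<in> K \<Longrightarrow> norm (g x) \<le> B"
    by (metis bounded_pos compact_imp_bounded image_eqI)
  then show ?thesis using assms(3) by (metis less_imp_le norm_zero)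
qed

lemma continuous_compact_support_L2:
  fixes g :: "'a::euclidean_space \<Rightarrow> 'b::euclidean_space"
  assumes c: "continuous_on UNIV g" and K: "compact K" "\<And>x. x \<notin> K \<Longrightarrow> g x = 0"
    and \<Omega>: "\<Omega> \<in> sets lebesgue"
  shows "g \<in> L2 \<Omega>"
proof (rule L2I)
  have gm: "g \<in> borel_measurable borel"
    using c by (rule borel_measurable_continuous_onI)
  then show "g \<in> borel_measurable (lebesgue_on \<Omega>)"
    by (intro measurable_restrict_space1 measurable_completion) simp
  have "integrable lborel (\<lambda>x. indicator K x *\<^sub>R (norm (g x))\<^sup>2)"
    by (rule borel_integrable_compact[OF K(1)])
      (intro continuous_intros continuous_on_subset[OF c], auto)
  also have "(\<lambda>x. indicator K x *\<^sub>R (norm (g x))\<^sup>2) = (\<lambda>x. (norm (g x))\<^sup>2)"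
    using K(2) by (auto simp: indicator_def fun_eq_iff)
  finally have "integrable lebesgue (\<lambda>x. (norm (g x))\<^sup>2)"
    using gm by (subst integrable_completion) auto
  then show "integrable (lebesgue_on \<Omega>) (\<lambda>x. (norm (g x))\<^sup>2)"
    using integrable_mult_indicator[OF \<Omega>, of "\<lambda>x. (norm (g x))\<^sup>2"] \<Omega>
    by (simp add: integrable_restrict_space)
qed

lemma test_function_continuous:
  assumes "\<phi> \<in> test_functions \<Omega>"
  shows "continuous_on UNIV \<phi>" "continuous_on UNIV (grad \<phi>)"
  using Ck_continuous[OF test_function_Ck[OF assms]] continuous_grad[OF test_function_Ck[OF assms]]
  by auto

lemma test_function_L2:
  assumes "\<phi> \<in> test_functions \<Omega>" "\<Omega>' \<in> sets lebesgue"
  shows "\<phi> \<in> L2 \<Omega>'" "grad \<phi> \<in> L2 \<Omega>'"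
proof -
  note c = continuous_compact_support_L2[OF _ test_function_support[OF assms(1)] _ assms(2)]
  show "\<phi> \<in> L2 \<Omega>'" "grad \<phi> \<in> L2 \<Omega>'"
    by (rule c; rule test_function_continuous[OF assms(1)] test_function_zero[OF assms(1)]; assumption)+
qed

lemma integral_lebesgue_on_zero_outside:
  fixes h :: "'a::euclidean_space \<Rightarrow> 'b::euclidean_space"
  assumes "\<Omega> \<in> sets lebesgue" "\<And>x. x \<notin> \<Omega> \<Longrightarrow> h x = 0"
  shows "(\<integral>x. h x \<partial>lebesgue_on \<Omega>) = (\<integral>x. h x \<partial>lebesgue)"
proof -
  have "(\<lambda>x. if x \<in> \<Omega> then h x else 0) = h" using assms(2) by auto
  then show ?thesis using Lebesgue_Measure.integral_restrict_UNIV[OF assms(1), of h] by simp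
qed

text \<open>\<open>f\<close> itself need not have compact support: the product of \<open>f\<close>
  with a test function does, and its partial derivatives are the components of the sum of the two
  integrands, so each has integral zero.\<close>

lemma is_weak_grad_grad:
  assumes "Ck (Suc 0) f" and f: "f \<in> L2 \<Omega>" "grad f \<in> L2 \<Omega>" and \<Omega>: "\<Omega> \<in> sets lebesgue"
  shows "is_weak_grad \<Omega> f (grad f)"
  unfolding is_weak_grad_def
proof
  fix \<psi> assume \<psi>: "\<psi> \<in> test_functions \<Omega>"
  note \<psi>2 = test_function_L2[OF \<psi> \<Omega>]
  have i1: "integrable (lebesgue_on \<Omega>) (\<lambda>x. f x *\<^sub>R grad \<psi> x)"
    by (rule L2_bilinear_bound(1)[OF f(1) \<psi>2(2)])
      (use L2_measurable[OF f(1)] L2_measurable[OF \<psi>2(2)] in auto)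
  have i2: "integrable (lebesgue_on \<Omega>) (\<lambda>x. \<psi> x *\<^sub>R grad f x)"
    by (rule L2_bilinear_bound(1)[OF \<psi>2(1) f(2)])
      (use L2_measurable[OF f(2)] L2_measurable[OF \<psi>2(1)] in auto)
  define h where "h x = f x *\<^sub>R grad \<psi> x + \<psi> x *\<^sub>R grad f x" for x
  have hi: "integrable (lebesgue_on \<Omega>) h" unfolding h_def using i1 i2 by simp
  have "(\<integral>x. h x \<partial>lebesgue_on \<Omega>) \<bullet> i = 0" if i: "i \<in> Basis" for i
  proof -
    have d: "((\<lambda>x. f x * \<psi> x) has_derivative (\<lambda>v. h x \<bullet> v)) (at x)" for x
      by (rule has_derivative_eq_rhs[OF has_derivative_mult[OF has_derivative_grad[OF assms(1)]
            has_derivative_grad[OF test_function_Ck[OF \<psi>, of "Suc 0"]]]])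
        (simp add: h_def inner_add_left mult.commute)
    have "continuous_on UNIV h" unfolding h_def
      by (intro continuous_intros test_function_continuous[OF \<psi>] continuous_grad[OF assms(1)] Ck_continuous[OF assms(1)])
    then have "\<exists>B>0. \<forall>x. norm (h x) \<le> B"
    proof (rule continuous_compact_support_bounded[OF _ test_function_support[OF \<psi>]])
      fix x assume "x \<notin> closure {x. \<psi> x \<noteq> 0}"
      from test_function_zero[OF \<psi> this] show "h x = 0" by (simp only: h_def) simp
    qed
    then obtain B where B: "\<And>x. norm (h x) \<le> B" by blast
    have "bounded {x. \<psi> x \<noteq> 0}"
      using test_function_support[OF \<psi>] by (simp only: compact_closure)
    then obtain R where "\<forall>x\<in>{x. \<psi> x \<noteq> 0}. norm x \<le> R"
      unfolding bounded_iff by blast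
    then have R: "\<And>x. f x * \<psi> x \<noteq> 0 \<Longrightarrow> norm x \<le> R" by simp
    have "(\<integral>x. h x \<bullet> i \<partial>lebesgue) = 0"
      by (rule partial_derivative_integral_zero(2)[where f = "\<lambda>x. f x * \<psi> x" and f' = "\<lambda>x v. h x \<bullet> v" and B = B, OF d _ i R])
        (use B Basis_le_norm[OF i] order_trans in blast)
    moreover have "h x = 0" if "x \<notin> \<Omega>" for x
      using test_function_zero_outside[OF \<psi> that] by (simp add: h_def)
    ultimately have "(\<integral>x. h x \<bullet> i \<partial>lebesgue_on \<Omega>) = 0"
      by (subst integral_lebesgue_on_zero_outside[OF \<Omega>]) auto
    then show ?thesis using hi by simp
  qed
  then have "(\<integral>x. h x \<partial>lebesgue_on \<Omega>) = 0"
    by (simp add: euclidean_eq_iff[of _ "0::'a"])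
  then show "(\<integral>x. f x *\<^sub>R grad \<psi> x \<partial>lebesgue_on \<Omega>) = - (\<integral>x. \<psi> x *\<^sub>R grad f x \<partial>lebesgue_on \<Omega>)"
    using i1 i2 by (simp add: h_def eq_neg_iff_add_eq_0)
qed

lemma test_function_weak_grad:
  assumes "\<phi> \<in> test_functions \<Omega>" "\<Omega> \<in> sets lebesgue"
  shows "is_weak_grad \<Omega> \<phi> (grad \<phi>)"
  using is_weak_grad_grad[OF test_function_Ck[OF assms(1)] test_function_L2[OF assms] assms(2)] .

text \<open>A smooth approximation of the indicator of the open box. Each argument is a signed
  distance to a face, and the factor \<open>n\<close> steepens the transition; no mass leaks out,
  since \<open>flat0\<close> vanishes for nonpositive arguments.\<close>

definition smooth_box :: "'a::euclidean_space \<Rightarrow> 'a \<Rightarrow> nat \<Rightarrow> 'a \<Rightarrow> real" where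
  "smooth_box a b n x =
     (\<Prod>i\<in>Basis. flat0 (real n * (x \<bullet> i - a \<bullet> i)) * flat0 (real n * (b \<bullet> i - x \<bullet> i)))"

lemma smooth_box_test_function:
  assumes "cbox a b \<subseteq> \<Omega>"
  shows "smooth_box a b n \<in> test_functions \<Omega>"
proof (rule test_functionI[OF _ compact_cbox assms])
  have *: "Ck k (\<lambda>x. x \<bullet> i)" for k and i :: 'a by (rule Ck_bounded_linear) (rule bounded_linear_inner_left)
  show "Ck k (smooth_box a b n)" for k
    unfolding smooth_box_def[abs_def] by (intro Ck_prod Ck_mult Ck_flat Ck_diff Ck_const *)
  fix x assume "x \<notin> cbox a b"
  then obtain i where i: "i \<in> Basis" "x \<bullet> i \<le> a \<bullet> i \<or> b \<bullet> i \<le> x \<bullet> i"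
    by (auto simp: mem_box)
  then have "real n * (x \<bullet> i - a \<bullet> i) \<le> 0 \<or> real n * (b \<bullet> i - x \<bullet> i) \<le> 0"
    by (auto simp: mult_le_0_iff)
  then have "flat0 (real n * (x \<bullet> i - a \<bullet> i)) * flat0 (real n * (b \<bullet> i - x \<bullet> i)) = 0"
    by (auto simp: flat0_nonpos)
  then show "smooth_box a b n x = 0"
    unfolding smooth_box_def using i(1) by (meson finite_Basis prod_zero)
qed

lemma smooth_box_tendsto: "(\<lambda>n. smooth_box a b n x) \<longlonglongrightarrow> indicator (box a b) x"
proof -
  have lim: "(\<lambda>n. flat0 (real n * s)) \<longlonglongrightarrow> (if s > 0 then 1 else 0)" for s
    using flat_scaled_tendsto[of 0 1 s] by (cases "s > 0") simp_all
  have "(\<lambda>n. smooth_box a b n x) \<longlonglongrightarrow>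
      (\<Prod>i\<in>Basis. (if x \<bullet> i - a \<bullet> i > 0 then 1 else 0) * (if b \<bullet> i - x \<bullet> i > 0 then 1 else 0))"
    unfolding smooth_box_def by (intro tendsto_intros lim)
  also have "(\<Prod>i\<in>Basis. (if x \<bullet> i - a \<bullet> i > 0 then 1 else 0) * (if b \<bullet> i - x \<bullet> i > 0 then 1 else 0)) =
      (indicator (box a b) x :: real)"
  proof (cases "x \<in> box a b")
    case True
    then show ?thesis by (auto simp: mem_box intro!: prod.neutral)
  next
    case False
    then obtain i where "i \<in> Basis" "\<not> (a \<bullet> i < x \<bullet> i \<and> x \<bullet> i < b \<bullet> i)"
      by (auto simp: mem_box)
    then have "(\<Prod>i\<in>Basis. (if x \<bullet> i - a \<bullet> i > 0 then 1 else 0) * (if b \<bullet> i - x \<bullet> i > 0 then 1 else 0)) = (0::real)"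
      by (intro prod_zero) auto
    then show ?thesis using False by simp
  qed
  finally show ?thesis .
qed

lemma smooth_box_bounds: "0 \<le> smooth_box a b n x" "smooth_box a b n x \<le> 1"
  unfolding smooth_box_def
  by (auto intro!: prod_nonneg prod_le_1 mult_le_one simp: flat0_nonneg flat0_le_1)

subsection \<open>Weak gradients\<close>

lemma integrable_test_scaleR:
  fixes G :: "'a::euclidean_space \<Rightarrow> 'b::euclidean_space"
  assumes "\<psi> \<in> L2 \<Omega>" "G \<in> L2 \<Omega>"
  shows "integrable (lebesgue_on \<Omega>) (\<lambda>x. \<psi> x *\<^sub>R G x)"
    and "norm (\<integral>x. \<psi> x *\<^sub>R G x \<partial>lebesgue_on \<Omega>) \<le> L2_norm \<Omega> \<psi> * L2_norm \<Omega> G"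
proof -
  have m: "(\<lambda>x. \<psi> x *\<^sub>R G x) \<in> borel_measurable (lebesgue_on \<Omega>)"
    by (intro borel_measurable_scaleR L2_measurable assms)
  show "integrable (lebesgue_on \<Omega>) (\<lambda>x. \<psi> x *\<^sub>R G x)"
    by (rule L2_bilinear_bound(1)[OF assms m]) simp
  show "norm (\<integral>x. \<psi> x *\<^sub>R G x \<partial>lebesgue_on \<Omega>) \<le> L2_norm \<Omega> \<psi> * L2_norm \<Omega> G"
    by (rule L2_bilinear_bound(2)[OF assms m]) simp
qed

lemma indicator_L2:
  assumes "S \<in> lmeasurable" "\<Omega> \<in> sets lebesgue"
  shows "(indicator S :: 'a::euclidean_space \<Rightarrow> real) \<in> L2 \<Omega>"
proof (rule L2I)
  have i: "integrable lebesgue (indicator S :: 'a \<Rightarrow> real)"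
    using assms(1) by (intro integrable_real_indicator) (auto simp: fmeasurable_def)
  then show "(indicator S :: 'a \<Rightarrow> real) \<in> borel_measurable (lebesgue_on \<Omega>)"
    by (intro measurable_restrict_space1 borel_measurable_integrable)
  have "(\<lambda>x. (norm (indicator S x :: real))\<^sup>2) = (indicator S :: 'a \<Rightarrow> real)"
    by (auto simp: fun_eq_iff indicator_def)
  then show "integrable (lebesgue_on \<Omega>) (\<lambda>x. (norm (indicator S x :: real))\<^sup>2)"
    using integrable_mult_indicator[OF assms(2) i] assms(2) by (simp add: integrable_restrict_space)
qed

text \<open>Dominated convergence passes from \<open>smooth_box a b n\<close> to the indicator of
  the open box, whose integral agrees with that over the closed box because the boundary is a null
  set.\<close>

lemma L2_orthogonal_test_functions_box:
  fixes G :: "'a::euclidean_space \<Rightarrow> 'b::euclidean_space"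
  assumes "\<Omega> \<in> sets lebesgue" and G: "G \<in> L2 \<Omega>"
    and orth: "\<And>\<psi>. \<psi> \<in> test_functions \<Omega> \<Longrightarrow> (\<integral>x. \<psi> x *\<^sub>R G x \<partial>lebesgue_on \<Omega>) = 0"
    and sub: "cbox a b \<subseteq> \<Omega>"
  shows "G integrable_on cbox a b" "integral (cbox a b) G = 0"
proof -
  have ind: "(indicator (cbox a b) :: 'a \<Rightarrow> real) \<in> L2 \<Omega>" "(indicator (box a b) :: 'a \<Rightarrow> real) \<in> L2 \<Omega>"
    using assms(1) by (auto intro: indicator_L2)
  \<comment> \<open>The majorant for dominated convergence; it is integrable as a product of two
    functions in \<open>L2\<close>.\<close>
  have i: "integrable (lebesgue_on \<Omega>) (\<lambda>x. indicator (cbox a b) x * norm (G x))"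
    using L2_product_integrable[OF ind(1) G] by simp
  have "(\<lambda>n. \<integral>x. smooth_box a b n x *\<^sub>R G x \<partial>lebesgue_on \<Omega>) \<longlonglongrightarrow>
      (\<integral>x. indicator (box a b) x *\<^sub>R G x \<partial>lebesgue_on \<Omega>)"
  proof (rule integral_dominated_convergence[OF _ _ i])
    show "(\<lambda>x. indicator (box a b) x *\<^sub>R G x) \<in> borel_measurable (lebesgue_on \<Omega>)"
      by (intro borel_measurable_scaleR L2_measurable G ind)
    show "(\<lambda>x. smooth_box a b n x *\<^sub>R G x) \<in> borel_measurable (lebesgue_on \<Omega>)" for n
      by (intro borel_measurable_scaleR L2_measurable G test_function_L2(1)[OF smooth_box_test_function[OF sub] assms(1)])
    show "AE x in lebesgue_on \<Omega>. (\<lambda>n. smooth_box a b n x *\<^sub>R G x) \<longlonglongrightarrow> indicator (box a b) x *\<^sub>R G x"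
      by (intro AE_I2 tendsto_intros smooth_box_tendsto)
    have "norm (smooth_box a b n x *\<^sub>R G x) \<le> indicator (cbox a b) x * norm (G x)" for n x
    proof (cases "x \<in> cbox a b")
      case True
      then show ?thesis using smooth_box_bounds[of a b n x] by (simp add: mult_left_le_one_le)
    next
      case False
      have "smooth_box a b n \<in> test_functions (cbox a b)" by (rule smooth_box_test_function) simp
      from test_function_zero_outside(1)[OF this False] show ?thesis by simp
    qed
    then show "AE x in lebesgue_on \<Omega>. norm (smooth_box a b n x *\<^sub>R G x) \<le> indicator (cbox a b) x * norm (G x)" for n
      by simp
  qed
  then have "(\<integral>x. indicator (box a b) x *\<^sub>R G x \<partial>lebesgue_on \<Omega>) = 0"
    by (simp add: orth[OF smooth_box_test_function[OF sub]] LIMSEQ_const_iff)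
  then have z: "(\<integral>x. (if x \<in> box a b then G x else 0) \<partial>lebesgue_on \<Omega>) = 0"
    by (simp add: indicator_scaleR_eq_if)
  have sub': "box a b \<subseteq> \<Omega>" using sub box_subset_cbox[of a b] by (rule order_trans[rotated])
  have ii: "integrable (lebesgue_on (cbox a b)) G"
  proof -
    have "integrable (lebesgue_on \<Omega>) (\<lambda>x. indicator (cbox a b) x *\<^sub>R G x)"
      by (rule integrable_test_scaleR(1)[OF ind(1) G])
    then have "integrable lebesgue (\<lambda>x. indicator \<Omega> x *\<^sub>R indicator (cbox a b) x *\<^sub>R G x)"
      using assms(1) by (simp add: integrable_restrict_space)
    also have "(\<lambda>x. indicator \<Omega> x *\<^sub>R indicator (cbox a b) x *\<^sub>R G x) = (\<lambda>x. indicator (cbox a b) x *\<^sub>R G x)"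
      using sub by (auto simp: fun_eq_iff indicator_def)
    finally show ?thesis by (simp add: integrable_restrict_space)
  qed
  show "G integrable_on cbox a b" by (rule integrable_on_lebesgue_on[OF ii]) simp
  have "integrable (lebesgue_on (box a b)) G"
  proof -
    have "integrable (lebesgue_on \<Omega>) (\<lambda>x. indicator (box a b) x *\<^sub>R G x)"
      by (rule integrable_test_scaleR(1)[OF ind(2) G])
    then have "integrable lebesgue (\<lambda>x. indicator \<Omega> x *\<^sub>R indicator (box a b) x *\<^sub>R G x)"
      using assms(1) by (simp add: integrable_restrict_space)
    also have "(\<lambda>x. indicator \<Omega> x *\<^sub>R indicator (box a b) x *\<^sub>R G x) = (\<lambda>x. indicator (box a b) x *\<^sub>R G x)"
      using sub' by (auto simp: fun_eq_iff indicator_def)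
    finally show ?thesis by (simp add: integrable_restrict_space)
  qed
  then have "integral\<^sup>L (lebesgue_on (box a b)) G = integral (box a b) G"
    by (rule lebesgue_integral_eq_integral) simp
  moreover have "integral\<^sup>L (lebesgue_on (box a b)) G = 0"
    using z Lebesgue_Measure.integral_restrict[OF sub' _ assms(1), of G] by simp
  ultimately show "integral (cbox a b) G = 0"
    by (simp add: integral_open_interval)
qed

text \<open>Lebesgue differentiation: almost everywhere the value is the limit of averages over
  cubes shrinking to the point, and here all averages are zero.\<close>

lemma negligible_of_zero_box_integrals:
  fixes G :: "'a::euclidean_space \<Rightarrow> 'b::euclidean_space"
  assumes int: "\<And>c d. cbox c d \<subseteq> cbox a b \<Longrightarrow> G integrable_on cbox c d"
    and zero: "\<And>c d. cbox c d \<subseteq> cbox a b \<Longrightarrow> integral (cbox c d) G = 0"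
  obtains N where "negligible N" "\<And>x. x \<in> cbox a b - N \<Longrightarrow> G x = 0"
proof -
  \<comment> \<open>The differentiation theorem asks for integrability over every box, hence the
    extension by zero. Boxes meet in boxes, so the extension inherits both hypotheses.\<close>
  define g where "g x = (if x \<in> cbox a b then G x else 0)" for x
  have g: "g integrable_on cbox c d" "integral (cbox c d) g = 0" for c d
  proof -
    obtain c' d' where eq: "cbox a b \<inter> cbox c d = cbox c' d'"
      by (rule that[OF Int_interval])
    have sub: "cbox c' d' \<subseteq> cbox a b" by (simp only: eq[symmetric] Int_lower1)
    show "g integrable_on cbox c d"
      unfolding g_def[abs_def] integrable_restrict_Int eq by (rule int[OF sub])
    show "integral (cbox c d) g = 0"
      unfolding g_def[abs_def] Henstock_Kurzweil_Integration.integral_restrict_Int eq by (rule zero[OF sub])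
  qed
  obtain N where N: "negligible N"
    "\<And>x e. \<lbrakk>x \<notin> N; 0 < e\<rbrakk> \<Longrightarrow>
       \<exists>d>0. \<forall>h. 0 < h \<and> h < d \<longrightarrow> norm (integral (cbox x (x + h *\<^sub>R One)) g /\<^sub>R h ^ DIM('a) - g x) < e"
    by (rule integrable_ccontinuous_explicit[OF g(1)]) blast
  have "g x = 0" if xN: "x \<notin> N" for x
  proof (rule ccontr)
    assume "g x \<noteq> 0"
    then obtain d where "d > 0" "\<forall>h. 0 < h \<and> h < d \<longrightarrow> norm (integral (cbox x (x + h *\<^sub>R One)) g /\<^sub>R h ^ DIM('a) - g x) < norm (g x)"
      using N(2)[OF xN, of "norm (g x)"] by auto
    \<comment> \<open>With all averages zero, closeness to \<open>g x\<close> up to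
      \<open>norm (g x)\<close> would read \<open>norm (g x) < norm (g x)\<close>.\<close>
    then show False by (auto simp: g(2) dest!: spec[of _ "d/2"])
  qed
  then show thesis using that[OF N(1)] by (metis DiffD1 DiffD2 g_def)
qed

text \<open>Smooth approximations of indicators of boxes show that all integrals of \<open>G\<close> over small boxes
  vanish; then Lebesgue differentiation applies.\<close>

lemma L2_orthogonal_test_functions:
  fixes G :: "'a::euclidean_space \<Rightarrow> 'b::euclidean_space"
  assumes "open \<Omega>" and G: "G \<in> L2 \<Omega>"
    and orth: "\<And>\<psi>. \<psi> \<in> test_functions \<Omega> \<Longrightarrow> (\<integral>x. \<psi> x *\<^sub>R G x \<partial>lebesgue_on \<Omega>) = 0"
  shows "AE x in lebesgue_on \<Omega>. G x = 0"
proof -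
  have \<Omega>: "\<Omega> \<in> sets lebesgue" using assms(1) by auto
  \<comment> \<open>Countably many boxes cover \<Omega>, so their exceptional null sets can be
    combined.\<close>
  obtain D where D: "countable D" "D \<subseteq> Pow \<Omega>" "\<And>X. X \<in> D \<Longrightarrow> \<exists>a b. X = cbox a b" "\<Union>D = \<Omega>"
    using open_countable_Union_open_cbox[OF assms(1)] by blast
  have "AE x in lebesgue. x \<in> X \<longrightarrow> G x = 0" if X: "X \<in> D" for X
  proof -
    obtain a b where ab: "X = cbox a b" using D(3)[OF X] by blast
    then have sub: "cbox a b \<subseteq> \<Omega>" using D(2) X by blast
    note box = L2_orthogonal_test_functions_box[OF \<Omega> G orth order_trans[OF _ sub]]
    obtain N where "negligible N" "\<And>x. x \<in> cbox a b - N \<Longrightarrow> G x = 0"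
      using negligible_of_zero_box_integrals[OF box] by blast
    then have "N \<in> null_sets lebesgue" "{x \<in> space lebesgue. \<not> (x \<in> X \<longrightarrow> G x = 0)} \<subseteq> N"
      by (auto simp: negligible_iff_null_sets ab)
    then show ?thesis by (rule AE_I')
  qed
  then have "AE x in lebesgue. \<forall>X\<in>D. x \<in> X \<longrightarrow> G x = 0"
    by (rule AE_ball_countable'[OF _ D(1)])
  then have "AE x in lebesgue. x \<in> \<Omega> \<longrightarrow> G x = 0"
    by (rule AE_mp) (use D(4) in \<open>auto intro!: AE_I2\<close>)
  then show ?thesis using \<Omega> by (simp add: AE_restrict_space_iff)
qed

lemma is_weak_grad_unique:
  assumes "open \<Omega>" "G \<in> L2 \<Omega>" "G' \<in> L2 \<Omega>" "is_weak_grad \<Omega> u G" "is_weak_grad \<Omega> u G'"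
  shows "AE x in lebesgue_on \<Omega>. G x = G' x"
proof -
  have \<Omega>: "\<Omega> \<in> sets lebesgue" using assms(1) by auto
  have "AE x in lebesgue_on \<Omega>. G x - G' x = 0"
  proof (rule L2_orthogonal_test_functions[OF assms(1) L2_diff_triangle(1)[OF assms(2,3)]])
    fix \<psi> assume \<psi>: "\<psi> \<in> test_functions \<Omega>"
    note p = test_function_L2(1)[OF \<psi> \<Omega>]
    have "(\<integral>x. \<psi> x *\<^sub>R G x \<partial>lebesgue_on \<Omega>) = (\<integral>x. \<psi> x *\<^sub>R G' x \<partial>lebesgue_on \<Omega>)"
      using bspec[OF assms(4)[unfolded is_weak_grad_def] \<psi>] bspec[OF assms(5)[unfolded is_weak_grad_def] \<psi>]
      by simp
    then show "(\<integral>x. \<psi> x *\<^sub>R (G x - G' x) \<partial>lebesgue_on \<Omega>) = 0"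
      using integrable_test_scaleR(1)[OF p assms(2)] integrable_test_scaleR(1)[OF p assms(3)]
      by (simp add: scaleR_diff_right)
  qed
  then show ?thesis by simp
qed

section \<open>The selected weak gradient and the space \<open>H10\<close>\<close>

lemma weak_grad:
  assumes "u \<in> H1 \<Omega>"
  shows "weak_grad \<Omega> u \<in> L2 \<Omega>" "is_weak_grad \<Omega> u (weak_grad \<Omega> u)"
proof -
  have "\<exists>G. G \<in> L2 \<Omega> \<and> is_weak_grad \<Omega> u G" using assms by (auto simp: H1_def)
  from someI_ex[OF this] show "weak_grad \<Omega> u \<in> L2 \<Omega>" "is_weak_grad \<Omega> u (weak_grad \<Omega> u)"
    by (auto simp: weak_grad_def)
qed

lemma H1I: "u \<in> L2 \<Omega> \<Longrightarrow> G \<in> L2 \<Omega> \<Longrightarrow> is_weak_grad \<Omega> u G \<Longrightarrow> u \<in> H1 \<Omega>"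
  by (auto simp: H1_def)

lemma weak_grad_AE_eq:
  assumes "open \<Omega>" "u \<in> L2 \<Omega>" "G \<in> L2 \<Omega>" "is_weak_grad \<Omega> u G"
  shows "AE x in lebesgue_on \<Omega>. weak_grad \<Omega> u x = G x"
  using is_weak_grad_unique[OF assms(1) weak_grad(1)[OF H1I[OF assms(2-4)]] assms(3) weak_grad(2)[OF H1I[OF assms(2-4)]] assms(4)] .

lemma is_weak_grad_diff:
  assumes "\<Omega> \<in> sets lebesgue" "u \<in> L2 \<Omega>" "G \<in> L2 \<Omega>" "is_weak_grad \<Omega> u G"
    and "v \<in> L2 \<Omega>" "H \<in> L2 \<Omega>" "is_weak_grad \<Omega> v H"
  shows "is_weak_grad \<Omega> (\<lambda>x. u x - v x) (\<lambda>x. G x - H x)"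
  unfolding is_weak_grad_def
proof
  fix \<psi> assume \<psi>: "\<psi> \<in> test_functions \<Omega>"
  note p = test_function_L2[OF \<psi> assms(1)]
  show "(\<integral>x. (u x - v x) *\<^sub>R grad \<psi> x \<partial>lebesgue_on \<Omega>) = - (\<integral>x. \<psi> x *\<^sub>R (G x - H x) \<partial>lebesgue_on \<Omega>)"
    using integrable_test_scaleR(1)[OF p(1) assms(3)] integrable_test_scaleR(1)[OF p(1) assms(6)]
      integrable_test_scaleR(1)[OF assms(2) p(2)] integrable_test_scaleR(1)[OF assms(5) p(2)]
      bspec[OF assms(4)[unfolded is_weak_grad_def] \<psi>] bspec[OF assms(7)[unfolded is_weak_grad_def] \<psi>]
    by (simp add: scaleR_diff_right scaleR_diff_left)
qed

text \<open>The norm of the difference involves a weak gradient selected for that difference,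
  unrelated by definition to the ones selected for \<open>u\<close>. Uniqueness up to null sets
  allows replacing it by \<open>G\<close> minus the classical gradient.\<close>

lemma H1_norm_diff_test:
  assumes "open \<Omega>" "u \<in> L2 \<Omega>" "G \<in> L2 \<Omega>" "is_weak_grad \<Omega> u G" and \<phi>: "\<phi> \<in> test_functions \<Omega>"
  shows "H1_norm \<Omega> (\<lambda>x. u x - \<phi> x) =
    sqrt ((L2_norm \<Omega> (\<lambda>x. u x - \<phi> x))\<^sup>2 + (L2_norm \<Omega> (\<lambda>x. G x - grad \<phi> x))\<^sup>2)"
proof -
  have \<Omega>: "\<Omega> \<in> sets lebesgue" using assms(1) by auto
  note p = test_function_L2[OF \<phi> \<Omega>]
  note l = L2_diff_triangle(1)[OF assms(2) p(1)] L2_diff_triangle(1)[OF assms(3) p(2)]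
  note w = is_weak_grad_diff[OF \<Omega> assms(2-4) p test_function_weak_grad[OF \<phi> \<Omega>]]
  have "L2_norm \<Omega> (weak_grad \<Omega> (\<lambda>x. u x - \<phi> x)) = L2_norm \<Omega> (\<lambda>x. G x - grad \<phi> x)"
    by (rule L2_norm_cong_AE[OF weak_grad(1)[OF H1I[OF l w]] l(2) weak_grad_AE_eq[OF assms(1) l w]])
  then show ?thesis
    unfolding H1_norm_def L2_norm_power2[symmetric] by (simp add: L2_norm_power2)
qed

lemma H10_H1: "u \<in> H10 \<Omega> \<Longrightarrow> u \<in> H1 \<Omega>"
  by (simp add: H10_def)

lemma H10_L2: "u \<in> H10 \<Omega> \<Longrightarrow> u \<in> L2 \<Omega>"
  by (simp add: H10_def H1_def)

lemma H10_weak_grad_L2: "u \<in> H10 \<Omega> \<Longrightarrow> weak_grad \<Omega> u \<in> L2 \<Omega>"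
  using weak_grad(1) H10_H1 by blast

lemma H10_approx:
  assumes "open \<Omega>" "u \<in> H10 \<Omega>" "0 < e"
  obtains \<phi> where "\<phi> \<in> test_functions \<Omega>" "L2_norm \<Omega> (\<lambda>x. u x - \<phi> x) < e"
    "L2_norm \<Omega> (\<lambda>x. weak_grad \<Omega> u x - grad \<phi> x) < e"
proof -
  obtain \<phi> where \<phi>: "\<phi> \<in> test_functions \<Omega>" "H1_norm \<Omega> (\<lambda>x. u x - \<phi> x) < e"
    using assms(2,3) by (auto simp: H10_def)
  let ?a = "L2_norm \<Omega> (\<lambda>x. u x - \<phi> x)" and ?b = "L2_norm \<Omega> (\<lambda>x. weak_grad \<Omega> u x - grad \<phi> x)"
  have s: "sqrt (?a\<^sup>2 + ?b\<^sup>2) < e"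
    using \<phi>(2) H1_norm_diff_test[OF assms(1) H10_L2[OF assms(2)] weak_grad[OF H10_H1[OF assms(2)]] \<phi>(1)]
    by simp
  have "?a \<le> sqrt (?a\<^sup>2 + ?b\<^sup>2)" "?b \<le> sqrt (?a\<^sup>2 + ?b\<^sup>2)"
    by (simp_all add: real_le_rsqrt)
  with s have "?a < e" "?b < e" by linarith+
  then show thesis using that \<phi>(1) by blast
qed

text \<open>That \<open>G\<close> is a weak gradient is a conclusion: the defining identity holds
  for each approximating test function, and both of its sides are continuous in the
  \<open>L2\<close> norms.\<close>

lemma H10I:
  assumes "open \<Omega>" "u \<in> L2 \<Omega>" "G \<in> L2 \<Omega>"
    and approx: "\<And>e. 0 < e \<Longrightarrow> \<exists>\<phi>\<in>test_functions \<Omega>.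
      L2_norm \<Omega> (\<lambda>x. u x - \<phi> x) < e \<and> L2_norm \<Omega> (\<lambda>x. G x - grad \<phi> x) < e"
  shows "u \<in> H10 \<Omega>" "AE x in lebesgue_on \<Omega>. weak_grad \<Omega> u x = G x"
proof -
  have \<Omega>: "\<Omega> \<in> sets lebesgue" using assms(1) by auto
  have w: "is_weak_grad \<Omega> u G"
    unfolding is_weak_grad_def
  proof
    fix \<psi> assume \<psi>: "\<psi> \<in> test_functions \<Omega>"
    note p = test_function_L2[OF \<psi> \<Omega>]
    \<comment> \<open>The defect of the identity. Test functions have defect zero, so subtracting an
      approximation from \<open>u\<close> and its gradient from \<open>G\<close> does not change
      \<open>A\<close>, but makes the Cauchy-Schwarz bound small.\<close>
    define A where "A = (\<integral>x. u x *\<^sub>R grad \<psi> x \<partial>lebesgue_on \<Omega>) + (\<integral>x. \<psi> x *\<^sub>R G x \<partial>lebesgue_on \<Omega>)"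
    \<comment> \<open>The defect is at most \<open>c\<close> times the approximation error; errors
      below \<open>e / (c + 1)\<close> avoid a division by zero.\<close>
    define c where "c = L2_norm \<Omega> (grad \<psi>) + L2_norm \<Omega> \<psi>"
    have c0: "0 \<le> c" by (simp add: c_def)
    have "norm A \<le> e" if "0 < e" for e
    proof -
      have "0 < e / (c + 1)" using that c0 by simp
      then obtain \<phi> where \<phi>: "\<phi> \<in> test_functions \<Omega>" "L2_norm \<Omega> (\<lambda>x. u x - \<phi> x) < e / (c + 1)"
        "L2_norm \<Omega> (\<lambda>x. G x - grad \<phi> x) < e / (c + 1)"
        using approx by blast
      note q = test_function_L2[OF \<phi>(1) \<Omega>]
      note d = L2_diff_triangle(1)[OF assms(2) q(1)] L2_diff_triangle(1)[OF assms(3) q(2)]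
      have z: "(\<integral>x. \<phi> x *\<^sub>R grad \<psi> x \<partial>lebesgue_on \<Omega>) + (\<integral>x. \<psi> x *\<^sub>R grad \<phi> x \<partial>lebesgue_on \<Omega>) = 0"
        using bspec[OF test_function_weak_grad[OF \<phi>(1) \<Omega>, unfolded is_weak_grad_def] \<psi>] by simp
      have X: "(\<integral>x. (u x - \<phi> x) *\<^sub>R grad \<psi> x \<partial>lebesgue_on \<Omega>) =
          (\<integral>x. u x *\<^sub>R grad \<psi> x \<partial>lebesgue_on \<Omega>) - (\<integral>x. \<phi> x *\<^sub>R grad \<psi> x \<partial>lebesgue_on \<Omega>)"
        using integrable_test_scaleR(1)[OF assms(2) p(2)] integrable_test_scaleR(1)[OF q(1) p(2)]
        by (simp add: scaleR_diff_left)
      have Y: "(\<integral>x. \<psi> x *\<^sub>R (G x - grad \<phi> x) \<partial>lebesgue_on \<Omega>) =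
          (\<integral>x. \<psi> x *\<^sub>R G x \<partial>lebesgue_on \<Omega>) - (\<integral>x. \<psi> x *\<^sub>R grad \<phi> x \<partial>lebesgue_on \<Omega>)"
        using integrable_test_scaleR(1)[OF p(1) assms(3)] integrable_test_scaleR(1)[OF p(1) q(2)]
        by (simp add: scaleR_diff_right)
      have "A = (\<integral>x. (u x - \<phi> x) *\<^sub>R grad \<psi> x \<partial>lebesgue_on \<Omega>) +
          (\<integral>x. \<psi> x *\<^sub>R (G x - grad \<phi> x) \<partial>lebesgue_on \<Omega>)"
        unfolding X Y A_def add_diff_add[symmetric] z by simp
      then have "norm A \<le> norm (\<integral>x. (u x - \<phi> x) *\<^sub>R grad \<psi> x \<partial>lebesgue_on \<Omega>) +
          norm (\<integral>x. \<psi> x *\<^sub>R (G x - grad \<phi> x) \<partial>lebesgue_on \<Omega>)"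
        using norm_triangle_ineq by simp
      also have "\<dots> \<le> L2_norm \<Omega> (\<lambda>x. u x - \<phi> x) * L2_norm \<Omega> (grad \<psi>) +
          L2_norm \<Omega> \<psi> * L2_norm \<Omega> (\<lambda>x. G x - grad \<phi> x)"
        by (intro add_mono integrable_test_scaleR(2) d p)
      also have "\<dots> \<le> e / (c + 1) * L2_norm \<Omega> (grad \<psi>) + L2_norm \<Omega> \<psi> * (e / (c + 1))"
        using \<phi>(2,3) by (intro add_mono mult_right_mono mult_left_mono) auto
      also have "\<dots> = e / (c + 1) * c" by (simp only: c_def distrib_left distrib_right mult.commute)
      also have "\<dots> \<le> e" using that c0 by (simp add: field_simps)
      finally show ?thesis .
    qed
    then have "norm A \<le> 0" by (rule field_le_epsilon) simp
    then show "(\<integral>x. u x *\<^sub>R grad \<psi> x \<partial>lebesgue_on \<Omega>) = - (\<integral>x. \<psi> x *\<^sub>R G x \<partial>lebesgue_on \<Omega>)"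
      by (simp add: A_def eq_neg_iff_add_eq_0)
  qed
  show "AE x in lebesgue_on \<Omega>. weak_grad \<Omega> u x = G x"
    by (rule weak_grad_AE_eq[OF assms(1-3) w])
  have "\<exists>\<phi>\<in>test_functions \<Omega>. H1_norm \<Omega> (\<lambda>x. u x - \<phi> x) < e" if "0 < e" for e
  proof -
    have "0 < e / 2" using that by simp
    then obtain \<phi> where \<phi>: "\<phi> \<in> test_functions \<Omega>" "L2_norm \<Omega> (\<lambda>x. u x - \<phi> x) < e / 2"
      "L2_norm \<Omega> (\<lambda>x. G x - grad \<phi> x) < e / 2"
      using approx by blast
    have "H1_norm \<Omega> (\<lambda>x. u x - \<phi> x) \<le> L2_norm \<Omega> (\<lambda>x. u x - \<phi> x) + L2_norm \<Omega> (\<lambda>x. G x - grad \<phi> x)"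
      unfolding H1_norm_diff_test[OF assms(1-3) w \<phi>(1)]
      by (rule sqrt_sum_squares_le_sum) auto
    with \<phi> show ?thesis by (intro bexI[of _ \<phi>]) auto
  qed
  then show "u \<in> H10 \<Omega>"
    using H1I[OF assms(2,3) w] by (simp add: H10_def)
qed

subsection \<open>Fields with divergence one\<close>

lemma L2_norm_scaleR: "L2_norm \<Omega> (\<lambda>x. c *\<^sub>R f x) = \<bar>c\<bar> * L2_norm \<Omega> f"
  by (simp add: L2_norm_def power_mult_distrib real_sqrt_mult)

lemma bounded_L2:
  fixes f :: "'a::euclidean_space \<Rightarrow> 'b::euclidean_space"
  assumes "\<Omega> \<in> lmeasurable" "f \<in> borel_measurable (lebesgue_on \<Omega>)" "\<And>x. x \<in> \<Omega> \<Longrightarrow> norm (f x) \<le> B"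
  shows "f \<in> L2 \<Omega>"
proof (rule L2I[OF assms(2)])
  interpret finite_measure "lebesgue_on \<Omega>" by (rule finite_measure_lebesgue_on[OF assms(1)])
  have "norm ((norm (f x))\<^sup>2) \<le> B\<^sup>2" if "x \<in> \<Omega>" for x
    using assms(3)[OF that] by (simp add: power_mono)
  then show "integrable (lebesgue_on \<Omega>) (\<lambda>x. (norm (f x))\<^sup>2)"
    using assms(2) by (intro integrable_const_bound[where B = "B\<^sup>2"] AE_I2) auto
qed

text \<open>The identity says that \<open>V\<close> has divergence 1 in the sense of distributions.
  No differentiability of \<open>V\<close> is asked for, so a field that jumps between components is
  admissible.\<close>

locale unit_divergence_field =
  fixes \<Omega> :: "'a::euclidean_space set" and V :: "'a \<Rightarrow> 'a" and M :: real
  assumes open_domain: "open \<Omega>" and domain: "\<Omega> \<in> lmeasurable"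
    and V_measurable: "V \<in> borel_measurable (lebesgue_on \<Omega>)"
    and V_bound: "\<And>x. norm (V x) \<le> M"
    and divergence: "\<And>\<psi>. \<psi> \<in> test_functions \<Omega> \<Longrightarrow>
      (\<integral>x. V x \<bullet> grad \<psi> x \<partial>lebesgue_on \<Omega>) = - (\<integral>x. \<psi> x \<partial>lebesgue_on \<Omega>)"
begin

lemma domain_sets: "\<Omega> \<in> sets lebesgue"
  using open_domain by auto

lemma V_L2: "V \<in> L2 \<Omega>"
  by (rule bounded_L2[OF domain V_measurable V_bound])

lemma M_nonneg: "0 \<le> M"
  using V_bound[of undefined] norm_ge_zero order_trans by blast

text \<open>Test the divergence identity with the square of the given function.\<close>

lemma Poincare_test_function:
  assumes \<phi>: "\<phi> \<in> test_functions \<Omega>"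
  shows "L2_norm \<Omega> \<phi> \<le> 2 * M * L2_norm \<Omega> (grad \<phi>)"
proof -
  note p = test_function_L2[OF \<phi> domain_sets]
  have sq: "(\<lambda>x. \<phi> x * \<phi> x) \<in> test_functions \<Omega>"
    by (rule test_function_mult[OF test_function_Ck[OF \<phi>] \<phi>])
  have g: "grad (\<lambda>x. \<phi> x * \<phi> x) x = (2 * \<phi> x) *\<^sub>R grad \<phi> x" for x
  proof (rule grad_eqI)
    note d = has_derivative_grad[OF test_function_Ck[OF \<phi>, of "Suc 0"], of x]
    show "((\<lambda>x. \<phi> x * \<phi> x) has_derivative (\<bullet>) ((2 * \<phi> x) *\<^sub>R grad \<phi> x)) (at x)"
      by (rule has_derivative_eq_rhs[OF has_derivative_mult[OF d d]]) (simp add: fun_eq_iff)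
  qed
  have "(L2_norm \<Omega> \<phi>)\<^sup>2 = (\<integral>x. \<phi> x * \<phi> x \<partial>lebesgue_on \<Omega>)"
    unfolding L2_norm_power2 by (simp add: power2_eq_square)
  also have "\<dots> = - (\<integral>x. V x \<bullet> ((2 * \<phi> x) *\<^sub>R grad \<phi> x) \<partial>lebesgue_on \<Omega>)"
    using divergence[OF sq] by (simp only: g minus_minus)
  also have "\<dots> \<le> norm (\<integral>x. V x \<bullet> ((2 * \<phi> x) *\<^sub>R grad \<phi> x) \<partial>lebesgue_on \<Omega>)"
    by simp
  also have "\<dots> \<le> L2_norm \<Omega> \<phi> * L2_norm \<Omega> (\<lambda>x. (2 * M) *\<^sub>R grad \<phi> x)"
  proof (rule L2_bilinear_bound(2)[OF p(1)])
    have m: "(\<lambda>x. (2 * M) *\<^sub>R grad \<phi> x) \<in> borel_measurable (lebesgue_on \<Omega>)"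
      by (intro borel_measurable_scaleR borel_measurable_const L2_measurable p)
    have "(\<lambda>x. (2 * M)\<^sup>2 * (norm (grad \<phi> x))\<^sup>2) = (\<lambda>x. (norm ((2 * M) *\<^sub>R grad \<phi> x))\<^sup>2)"
      by (simp add: power_mult_distrib)
    then show "(\<lambda>x. (2 * M) *\<^sub>R grad \<phi> x) \<in> L2 \<Omega>"
      using integrable_mult_right[OF L2_integrable[OF p(2)], of "(2 * M)\<^sup>2"] by (intro L2I[OF m]) simp
    show "(\<lambda>x. V x \<bullet> ((2 * \<phi> x) *\<^sub>R grad \<phi> x)) \<in> borel_measurable (lebesgue_on \<Omega>)"
      by (intro borel_measurable_inner borel_measurable_scaleR borel_measurable_times
          borel_measurable_const V_measurable L2_measurable p)
    fix x
    have "norm (V x \<bullet> grad \<phi> x) \<le> M * norm (grad \<phi> x)"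
      using Cauchy_Schwarz_ineq2[of "V x" "grad \<phi> x"] mult_right_mono[OF V_bound[of x], of "norm (grad \<phi> x)"]
      by simp
    then have "norm (2 * \<phi> x) * norm (V x \<bullet> grad \<phi> x) \<le> norm (2 * \<phi> x) * (M * norm (grad \<phi> x))"
      by (rule mult_left_mono) simp
    then show "norm (V x \<bullet> ((2 * \<phi> x) *\<^sub>R grad \<phi> x)) \<le> norm (\<phi> x) * norm ((2 * M) *\<^sub>R grad \<phi> x)"
      using M_nonneg by (simp add: abs_mult mult.assoc mult.left_commute)
  qed
  finally have "L2_norm \<Omega> \<phi> * L2_norm \<Omega> \<phi> \<le> L2_norm \<Omega> \<phi> * (2 * M * L2_norm \<Omega> (grad \<phi>))"
    using M_nonneg by (simp add: L2_norm_scaleR power2_eq_square)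
  moreover have "0 \<le> 2 * M * L2_norm \<Omega> (grad \<phi>)" using M_nonneg by simp
  \<comment> \<open>One factor \<open>L2_norm \<Omega> \<phi>\<close> is cancelled; if it is zero,
    the claim only says that the right side is nonnegative.\<close>
  ultimately show ?thesis
    using L2_norm_nonneg[of \<Omega> \<phi>] by (metis mult_le_cancel_left_pos order_le_less)
qed

text \<open>Density: both sides depend continuously on \<open>u\<close> and its weak
  gradient.\<close>

lemma Poincare:
  assumes u: "u \<in> H10 \<Omega>"
  shows "L2_norm \<Omega> u \<le> 2 * M * L2_norm \<Omega> (weak_grad \<Omega> u)"
proof (rule field_le_epsilon)
  fix e :: real assume e: "0 < e"
  \<comment> \<open>Approximation costs \<open>e'\<close> on the left side and
    \<open>2 * M * e'\<close> on the right side, together \<open>e\<close>.\<close>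
  define e' where "e' = e / (2 * M + 1)"
  have "0 < 2 * M + 1" using M_nonneg by linarith
  then have e': "0 < e'" "(2 * M + 1) * e' = e" using e by (simp_all add: e'_def)
  obtain \<phi> where \<phi>: "\<phi> \<in> test_functions \<Omega>" "L2_norm \<Omega> (\<lambda>x. u x - \<phi> x) < e'"
    "L2_norm \<Omega> (\<lambda>x. weak_grad \<Omega> u x - grad \<phi> x) < e'"
    by (rule H10_approx[OF open_domain u e'(1)])
  note p = test_function_L2[OF \<phi>(1) domain_sets]
  note ul = H10_L2[OF u] H10_weak_grad_L2[OF u]
  have sym: "L2_norm \<Omega> (\<lambda>x. grad \<phi> x - weak_grad \<Omega> u x) = L2_norm \<Omega> (\<lambda>x. weak_grad \<Omega> u x - grad \<phi> x)"
    by (simp add: L2_norm_def norm_minus_commute)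
  have "L2_norm \<Omega> u \<le> L2_norm \<Omega> \<phi> + L2_norm \<Omega> (\<lambda>x. u x - \<phi> x)"
    by (rule L2_diff_triangle(3)[OF ul(1) p(1)])
  also have "\<dots> \<le> 2 * M * L2_norm \<Omega> (grad \<phi>) + e'"
    using Poincare_test_function[OF \<phi>(1)] \<phi>(2) by simp
  also have "\<dots> \<le> 2 * M * (L2_norm \<Omega> (weak_grad \<Omega> u) + e') + e'"
    using L2_diff_triangle(3)[OF p(2) ul(2)] \<phi>(3) M_nonneg unfolding sym
    by (intro add_right_mono mult_left_mono) auto
  also have "\<dots> = 2 * M * L2_norm \<Omega> (weak_grad \<Omega> u) + e"
    by (simp only: e'(2)[symmetric] distrib_left distrib_right mult_1 add.assoc)
  finally show "L2_norm \<Omega> u \<le> 2 * M * L2_norm \<Omega> (weak_grad \<Omega> u) + e" .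
qed

text \<open>The given \<open>u\<close> only guarantees that the infimum is taken over a nonempty
  set; the bound for each quotient is the squared Poincare inequality.\<close>

lemma dirichlet_eigenvalue_ge:
  assumes "0 < M" "u \<in> H10 \<Omega>" "\<not> (AE x in lebesgue_on \<Omega>. u x = 0)"
  shows "1 / (4 * M\<^sup>2) \<le> dirichlet_eigenvalue \<Omega>"
  unfolding dirichlet_eigenvalue_def
proof (rule cInf_greatest)
  fix r assume "r \<in> {(\<integral>x. (norm (weak_grad \<Omega> u x))\<^sup>2 \<partial>lebesgue_on \<Omega>) / (\<integral>x. (u x)\<^sup>2 \<partial>lebesgue_on \<Omega>) | u.
          u \<in> H10 \<Omega> \<and> \<not> (AE x in lebesgue_on \<Omega>. u x = 0)}"
  then obtain u where u: "u \<in> H10 \<Omega>" "\<not> (AE x in lebesgue_on \<Omega>. u x = 0)"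
    "r = (\<integral>x. (norm (weak_grad \<Omega> u x))\<^sup>2 \<partial>lebesgue_on \<Omega>) / (\<integral>x. (u x)\<^sup>2 \<partial>lebesgue_on \<Omega>)"
    by blast
  have i: "integrable (lebesgue_on \<Omega>) (\<lambda>x. (u x)\<^sup>2)"
    using L2_integrable[OF H10_L2[OF u(1)]] by simp
  have "(\<integral>x. (u x)\<^sup>2 \<partial>lebesgue_on \<Omega>) \<noteq> 0"
    using integral_nonneg_eq_0_iff_AE[OF i] u(2) by simp
  then have pos: "0 < (\<integral>x. (u x)\<^sup>2 \<partial>lebesgue_on \<Omega>)"
    by (simp add: order_less_le)
  have "(L2_norm \<Omega> u)\<^sup>2 \<le> (2 * M * L2_norm \<Omega> (weak_grad \<Omega> u))\<^sup>2"
    by (rule power_mono[OF Poincare[OF u(1)]]) simp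
  then have "(\<integral>x. (u x)\<^sup>2 \<partial>lebesgue_on \<Omega>) \<le> 4 * M\<^sup>2 * (\<integral>x. (norm (weak_grad \<Omega> u x))\<^sup>2 \<partial>lebesgue_on \<Omega>)"
    by (simp add: power_mult_distrib L2_norm_power2)
  then show "1 / (4 * M\<^sup>2) \<le> r"
    using pos assms(1) by (simp add: u(3) field_simps)
qed (use assms in blast)

text \<open>With gradient \<open>- V\<close>, the weak equation tested with a test function is the
  divergence identity. Both sides are continuous in the \<open>H1\<close> norm, so density gives it
  for every \<open>v\<close> in \<open>H10\<close>.\<close>

lemma torsion_weak_solutionI:
  assumes w: "w \<in> H10 \<Omega>" and gw: "AE x in lebesgue_on \<Omega>. weak_grad \<Omega> w x = - V x"
  shows "torsion_weak_solution \<Omega> w"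
  unfolding torsion_weak_solution_def
proof (intro conjI ballI w)
  fix v assume v: "v \<in> H10 \<Omega>"
  note vl = H10_L2[OF v] H10_weak_grad_L2[OF v]
  note wl = H10_weak_grad_L2[OF w]
  have one: "(\<lambda>_. 1 :: real) \<in> L2 \<Omega>"
    by (rule bounded_L2[OF domain, where B = 1]) auto
  have int_V: "integrable (lebesgue_on \<Omega>) (\<lambda>x. V x \<bullet> G x)"
    "norm (\<integral>x. V x \<bullet> G x \<partial>lebesgue_on \<Omega>) \<le> L2_norm \<Omega> V * L2_norm \<Omega> G" if G: "G \<in> L2 \<Omega>" for G
  proof -
    have m: "(\<lambda>x. V x \<bullet> G x) \<in> borel_measurable (lebesgue_on \<Omega>)"
      by (intro borel_measurable_inner L2_measurable V_L2 G)
    show "integrable (lebesgue_on \<Omega>) (\<lambda>x. V x \<bullet> G x)"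
      by (rule L2_bilinear_bound(1)[OF V_L2 G m]) (use Cauchy_Schwarz_ineq2 in auto)
    show "norm (\<integral>x. V x \<bullet> G x \<partial>lebesgue_on \<Omega>) \<le> L2_norm \<Omega> V * L2_norm \<Omega> G"
      by (rule L2_bilinear_bound(2)[OF V_L2 G m]) (use Cauchy_Schwarz_ineq2 in auto)
  qed
  have int_1: "integrable (lebesgue_on \<Omega>) f"
    "norm (\<integral>x. f x \<partial>lebesgue_on \<Omega>) \<le> L2_norm \<Omega> (\<lambda>_. 1 :: real) * L2_norm \<Omega> f" if f: "f \<in> L2 \<Omega>" for f :: "'a \<Rightarrow> real"
    using L2_bilinear_bound[OF one f L2_measurable[OF f]] by auto
  \<comment> \<open>Again a defect that vanishes on test functions, hence is unchanged when an
    approximation is subtracted from \<open>v\<close>.\<close>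
  define A where "A = (\<integral>x. V x \<bullet> weak_grad \<Omega> v x \<partial>lebesgue_on \<Omega>) + (\<integral>x. v x \<partial>lebesgue_on \<Omega>)"
  define c where "c = L2_norm \<Omega> V + L2_norm \<Omega> (\<lambda>_. 1 :: real)"
  have c0: "0 \<le> c" by (simp add: c_def)
  have "norm A \<le> e" if "0 < e" for e
  proof -
    have e': "0 < e / (c + 1)" using that c0 by simp
    obtain \<phi> where \<phi>: "\<phi> \<in> test_functions \<Omega>" "L2_norm \<Omega> (\<lambda>x. v x - \<phi> x) < e / (c + 1)"
      "L2_norm \<Omega> (\<lambda>x. weak_grad \<Omega> v x - grad \<phi> x) < e / (c + 1)"
      by (rule H10_approx[OF open_domain v e'])
    note p = test_function_L2[OF \<phi>(1) domain_sets]
    note d = L2_diff_triangle(1)[OF vl(1) p(1)] L2_diff_triangle(1)[OF vl(2) p(2)]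
    have "A = (\<integral>x. V x \<bullet> (weak_grad \<Omega> v x - grad \<phi> x) \<partial>lebesgue_on \<Omega>) + (\<integral>x. v x - \<phi> x \<partial>lebesgue_on \<Omega>)"
      using int_V(1)[OF vl(2)] int_V(1)[OF p(2)] int_1(1)[OF vl(1)] int_1(1)[OF p(1)] divergence[OF \<phi>(1)]
      by (simp add: A_def inner_diff_right)
    then have "norm A \<le> norm (\<integral>x. V x \<bullet> (weak_grad \<Omega> v x - grad \<phi> x) \<partial>lebesgue_on \<Omega>) + norm (\<integral>x. v x - \<phi> x \<partial>lebesgue_on \<Omega>)"
      using norm_triangle_ineq by simp
    also have "\<dots> \<le> L2_norm \<Omega> V * L2_norm \<Omega> (\<lambda>x. weak_grad \<Omega> v x - grad \<phi> x) +
        L2_norm \<Omega> (\<lambda>_. 1 :: real) * L2_norm \<Omega> (\<lambda>x. v x - \<phi> x)"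
      by (intro add_mono int_V(2) int_1(2) d)
    also have "\<dots> \<le> L2_norm \<Omega> V * (e / (c + 1)) + L2_norm \<Omega> (\<lambda>_. 1 :: real) * (e / (c + 1))"
      using \<phi>(2,3) by (intro add_mono mult_left_mono) auto
    also have "\<dots> = c * (e / (c + 1))" by (simp only: c_def distrib_right)
    also have "\<dots> \<le> e" using that c0 by (simp add: field_simps)
    finally show ?thesis .
  qed
  then have "norm A \<le> 0" by (rule field_le_epsilon) simp
  then have "(\<integral>x. v x \<partial>lebesgue_on \<Omega>) = - (\<integral>x. V x \<bullet> weak_grad \<Omega> v x \<partial>lebesgue_on \<Omega>)"
    by (simp add: A_def)
  also have "\<dots> = (\<integral>x. - (V x \<bullet> weak_grad \<Omega> v x) \<partial>lebesgue_on \<Omega>)" by simp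
  also have "\<dots> = (\<integral>x. weak_grad \<Omega> w x \<bullet> weak_grad \<Omega> v x \<partial>lebesgue_on \<Omega>)"
  proof (rule integral_cong_AE)
    show "AE x in lebesgue_on \<Omega>. - (V x \<bullet> weak_grad \<Omega> v x) = weak_grad \<Omega> w x \<bullet> weak_grad \<Omega> v x"
      using gw by eventually_elim simp
    show "(\<lambda>x. - (V x \<bullet> weak_grad \<Omega> v x)) \<in> borel_measurable (lebesgue_on \<Omega>)"
      by (intro borel_measurable_uminus borel_measurable_inner L2_measurable V_L2 vl)
    show "(\<lambda>x. weak_grad \<Omega> w x \<bullet> weak_grad \<Omega> v x) \<in> borel_measurable (lebesgue_on \<Omega>)"
      by (intro borel_measurable_inner L2_measurable wl vl)
  qed
  finally show "(\<integral>x. weak_grad \<Omega> w x \<bullet> weak_grad \<Omega> v x \<partial>lebesgue_on \<Omega>) = (\<integral>x. v x \<partial>lebesgue_on \<Omega>)" ..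
qed

end

text \<open>Testing each of two weak solutions with the other one shows that they have the same integral.\<close>

lemma torsional_rigidity_eq:
  assumes w: "torsion_weak_solution \<Omega> w"
  shows "torsional_rigidity \<Omega> = (\<integral>x. w x \<partial>lebesgue_on \<Omega>)"
proof -
  let ?w = "torsion_function \<Omega>"
  have w': "torsion_weak_solution \<Omega> ?w"
    unfolding torsion_function_def by (rule someI[of "torsion_weak_solution \<Omega>", OF w])
  have "(\<integral>x. ?w x \<partial>lebesgue_on \<Omega>) = (\<integral>x. weak_grad \<Omega> w x \<bullet> weak_grad \<Omega> ?w x \<partial>lebesgue_on \<Omega>)"
    using w w' by (simp add: torsion_weak_solution_def)
  also have "\<dots> = (\<integral>x. weak_grad \<Omega> ?w x \<bullet> weak_grad \<Omega> w x \<partial>lebesgue_on \<Omega>)"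
    by (simp add: inner_commute)
  also have "\<dots> = (\<integral>x. w x \<partial>lebesgue_on \<Omega>)"
    using w w' by (simp add: torsion_weak_solution_def)
  finally show ?thesis by (simp add: torsional_rigidity_def)
qed

subsection \<open>Disjoint unions of balls\<close>

text \<open>Distance 2 is the least separation that keeps open unit balls disjoint; they may touch.
  The centres form an infinite sequence, so the number \<open>N\<close> of balls can grow while the
  centres stay fixed.\<close>

locale separated_balls =
  fixes a :: "nat \<Rightarrow> 'a::euclidean_space" and N :: nat
  assumes separated: "\<And>i j. i \<noteq> j \<Longrightarrow> 2 \<le> dist (a i) (a j)"
begin

text \<open>Radius 1 gives the domain, radius 1/2 the subset on which the torsion function is
  bounded below by a constant.\<close>

definition balls :: "real \<Rightarrow> 'a set" where
  "balls r = (\<Union>k<N. ball (a k) r)"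

text \<open>The vector from the centre of the ball containing \<open>x\<close> to \<open>x\<close>,
  extended by zero. Writing it as a sum of indicators, without choosing a centre, makes Borel
  measurability immediate.\<close>

definition offset :: "'a \<Rightarrow> 'a" where
  "offset x = (\<Sum>k<N. indicator (ball (a k) 1) x *\<^sub>R (x - a k))"

lemma far_from_other_centres:
  assumes "x \<in> ball (a k) 1" "j \<noteq> k"
  shows "1 < dist (a j) x"
  using separated[OF assms(2)] dist_triangle[of "a j" "a k" x] assms(1) by (simp add: dist_commute)

lemma offset_ball:
  assumes "k < N" "x \<in> ball (a k) 1"
  shows "offset x = x - a k"
proof -
  have "offset x = (\<Sum>j<N. if j = k then x - a k else 0)"
    unfolding offset_def
    by (intro sum.cong refl) (use assms(2) far_from_other_centres[OF assms(2)] in \<open>force simp: indicator_def\<close>)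
  then show ?thesis using assms(1) by simp
qed

lemma offset_outside: "x \<notin> balls 1 \<Longrightarrow> offset x = 0"
  by (auto simp: offset_def balls_def intro!: sum.neutral)

lemma ball_cases:
  assumes "x \<in> balls 1"
  obtains k where "k < N" "x \<in> ball (a k) 1" "offset x = x - a k"
  using assms offset_ball by (auto simp: balls_def)

lemma norm_offset_less: "norm (offset x) < 1"
proof (cases "x \<in> balls 1")
  case True
  then show ?thesis by (rule ball_cases) (simp add: dist_norm norm_minus_commute)
qed (simp add: offset_outside)

lemma offset_borel: "offset \<in> borel_measurable borel"
  unfolding offset_def[abs_def]
  by (intro borel_measurable_sum borel_measurable_scaleR borel_measurable_indicator
      borel_measurable_diff borel_measurable_const measurable_ident_sets borel_open) auto

lemma balls_open: "open (balls r)"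
  by (auto simp: balls_def)

lemma balls_lmeasurable: "balls r \<in> lmeasurable"
  unfolding balls_def by (intro fmeasurable.finite_UN) auto

lemma measure_balls:
  assumes "0 \<le> r" "r \<le> 1"
  shows "measure lebesgue (balls r) = real N * (unit_ball_vol DIM('a) * r ^ DIM('a))"
proof -
  have "disjnt (ball (a i) r) (ball (a j) r)" if "i \<noteq> j" for i j
  proof -
    have "\<not> (dist (a i) x < r \<and> dist (a j) x < r)" for x
      using separated[OF that] dist_triangle[of "a i" "a j" x] assms(2) by (simp add: dist_commute)
    then show ?thesis by (auto simp: disjnt_iff)
  qed
  then have "measure lebesgue (balls r) = (\<Sum>k<N. measure lebesgue (ball (a k) r))"
    unfolding balls_def by (intro measure_UNION') (auto simp: pairwise_def)
  then show ?thesis using assms(1) by (simp add: content_ball)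
qed

text \<open>The product of \<psi> and \<open>offset\<close> is differentiable everywhere: inside a
  ball \<open>offset\<close> is affine with divergence d, and its jumps on the spheres lie off the
  support of \<psi>. Hence the divergence of the product has integral zero.\<close>

lemma offset_divergence:
  assumes \<psi>: "\<psi> \<in> test_functions (balls 1)"
  shows "(\<integral>x. offset x \<bullet> grad \<psi> x \<partial>lebesgue_on (balls 1)) = - (real DIM('a) * (\<integral>x. \<psi> x \<partial>lebesgue_on (balls 1)))"
proof -
  let ?S = "closure {x. \<psi> x \<noteq> 0}"
  have dom: "balls 1 \<in> sets lebesgue" using balls_open by auto
  have S: "compact ?S" "?S \<subseteq> balls 1" using \<psi> by (auto simp: test_functions_def)
  have d\<psi>: "(\<psi> has_derivative (\<lambda>v. grad \<psi> x \<bullet> v)) (at x)" for x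
    by (rule has_derivative_grad[OF test_function_Ck[OF \<psi>, of "Suc 0"]])
  \<comment> \<open>The derivative along \<open>v\<close> of the \<open>i\<close>-th component of
    the product; summing \<open>D x i i\<close> over the basis gives its divergence.\<close>
  define D where "D x v i = (grad \<psi> x \<bullet> v) * (offset x \<bullet> i) + \<psi> x * (v \<bullet> i)" for x v i
  have der: "((\<lambda>x. \<psi> x * (offset x \<bullet> i)) has_derivative (\<lambda>v. D x v i)) (at x)" for x i
  proof (cases "x \<in> balls 1")
    case True
    then obtain k where k: "k < N" "x \<in> ball (a k) 1" "offset x = x - a k" by (rule ball_cases)
    have "((\<lambda>x. \<psi> x * ((x - a k) \<bullet> i)) has_derivative (\<lambda>v. D x v i)) (at x)"
      unfolding D_def k(3)
      by (rule has_derivative_eq_rhs, rule has_derivative_mult[OF d\<psi>], (rule derivative_intros)+) auto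
    then show ?thesis
      by (rule has_derivative_transform_within_open[where s = "ball (a k) 1"])
        (use k offset_ball[OF k(1)] in auto)
  next
    case False
    have 0: "\<psi> x = 0" "grad \<psi> x = 0" using test_function_zero_outside[OF \<psi> False] by auto
    have "((\<lambda>x. 0) has_derivative (\<lambda>v. D x v i)) (at x)"
      by (simp add: D_def 0)
    \<comment> \<open>Off the balls \<open>offset\<close> need not be continuous, but \<psi>
      vanishes on a whole neighbourhood of \<open>x\<close>.\<close>
    moreover have "open (- ?S)" "x \<in> - ?S" using S(2) False by auto
    moreover have "0 = \<psi> y * (offset y \<bullet> i)" if "y \<in> - ?S" for y
      using test_function_zero(1)[OF \<psi>, of y] that by simp
    ultimately show ?thesis
      by (rule has_derivative_transform_within_open)
  qed
  obtain B1 where B1: "\<And>x. norm (\<psi> x) \<le> B1"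
    using continuous_compact_support_bounded[OF test_function_continuous(1)[OF \<psi>] S(1) test_function_zero(1)[OF \<psi>]] by blast
  obtain B2 where B2: "\<And>x. norm (grad \<psi> x) \<le> B2"
    using continuous_compact_support_bounded[OF test_function_continuous(2)[OF \<psi>] S(1) test_function_zero(2)[OF \<psi>]] by blast
  have bound: "\<bar>D x i i\<bar> \<le> B2 + B1" if i: "i \<in> Basis" for x i
  proof -
    have "\<bar>grad \<psi> x \<bullet> i\<bar> * \<bar>offset x \<bullet> i\<bar> \<le> B2 * 1"
      using Basis_le_norm[OF i, of "grad \<psi> x"] Basis_le_norm[OF i, of "offset x"] B2[of x] norm_offset_less[of x]
      by (intro mult_mono) auto
    moreover have "\<bar>D x i i\<bar> \<le> \<bar>grad \<psi> x \<bullet> i\<bar> * \<bar>offset x \<bullet> i\<bar> + \<bar>\<psi> x\<bar>"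
      unfolding D_def abs_mult[symmetric] using i by (simp add: abs_triangle_ineq)
    ultimately show ?thesis using B1[of x] by simp
  qed
  have "bounded {x. \<psi> x \<noteq> 0}" using S(1) by (simp only: compact_closure)
  then obtain R where "\<forall>x\<in>{x. \<psi> x \<noteq> 0}. norm x \<le> R" unfolding bounded_iff by blast
  then have R: "\<And>x i. \<psi> x * (offset x \<bullet> i) \<noteq> 0 \<Longrightarrow> norm x \<le> R" by simp
  have int: "integrable lebesgue (\<lambda>x. D x i i)" "(\<integral>x. D x i i \<partial>lebesgue) = 0" if i: "i \<in> Basis" for i
  proof -
    note p = partial_derivative_integral_zero[where f = "\<lambda>x. \<psi> x * (offset x \<bullet> i)" and
        f' = "\<lambda>x v. D x v i" and B = "B2 + B1" and R = R, OF der bound[OF i] i R]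
    show "integrable lebesgue (\<lambda>x. D x i i)" by (rule p(1))
    show "(\<integral>x. D x i i \<partial>lebesgue) = 0" by (rule p(2))
  qed
  have sumD: "(\<Sum>i\<in>Basis. D x i i) = offset x \<bullet> grad \<psi> x + real DIM('a) * \<psi> x" for x
    by (simp add: D_def sum.distrib euclidean_inner[of "offset x" "grad \<psi> x"] mult.commute)
  have "(\<integral>x. (\<Sum>i\<in>Basis. D x i i) \<partial>lebesgue) = (\<Sum>i\<in>Basis. \<integral>x. D x i i \<partial>lebesgue)"
    by (rule Bochner_Integration.integral_sum) (rule int(1), assumption+)
  also have "\<dots> = 0"
    by (rule sum.neutral, rule ballI, rule int(2), assumption+)
  finally have z: "(\<integral>x. offset x \<bullet> grad \<psi> x + real DIM('a) * \<psi> x \<partial>lebesgue) = 0"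
    unfolding sumD .
  have "(\<integral>x. offset x \<bullet> grad \<psi> x + real DIM('a) * \<psi> x \<partial>lebesgue_on (balls 1)) = 0"
  proof (subst integral_lebesgue_on_zero_outside[OF dom])
    show "offset x \<bullet> grad \<psi> x + real DIM('a) * \<psi> x = 0" if "x \<notin> balls 1" for x
      using test_function_zero_outside[OF \<psi> that] by simp
  qed (rule z)
  moreover have om: "offset \<in> borel_measurable (lebesgue_on (balls 1))"
    using offset_borel by (intro measurable_restrict_space1 measurable_completion) simp
  have one: "offset \<in> L2 (balls 1)" "(\<lambda>_. 1 :: real) \<in> L2 (balls 1)"
    by (rule bounded_L2[OF balls_lmeasurable om], rule less_imp_le[OF norm_offset_less])
      (rule bounded_L2[OF balls_lmeasurable, where B = 1], auto)
  note p = test_function_L2[OF \<psi> dom]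
  have "integrable (lebesgue_on (balls 1)) (\<lambda>x. offset x \<bullet> grad \<psi> x)"
    by (rule L2_bilinear_bound(1)[OF one(1) p(2)])
      (use om L2_measurable[OF p(2)] Cauchy_Schwarz_ineq2 in auto)
  moreover have "integrable (lebesgue_on (balls 1)) \<psi>"
    by (rule L2_bilinear_bound(1)[OF one(2) p(1) L2_measurable[OF p(1)]]) simp
  ultimately show ?thesis by simp
qed

section \<open>The torsion function of the union and its approximation by test functions\<close>

definition field :: "'a \<Rightarrow> 'a" where
  "field x = offset x /\<^sub>R real DIM('a)"

text \<open>Outside the balls this is the constant 1/(2d), because \<open>offset\<close> is 0 there.
  The value is irrelevant to the Sobolev notions and lets the bounds below hold at every
  point.\<close>

definition torsion :: "'a \<Rightarrow> real" where
  "torsion x = (1 - (norm (offset x))\<^sup>2) / (2 * real DIM('a))"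

text \<open>The same paraboloid for a single centre, but on the whole space: it is smooth everywhere
  and nonpositive outside its ball, so \<open>cutoff\<close> can remove that part.\<close>

definition profile :: "nat \<Rightarrow> 'a \<Rightarrow> real" where
  "profile k x = (1 - (x - a k) \<bullet> (x - a k)) / (2 * real DIM('a))"

text \<open>Each summand lives inside its own ball, since \<open>cutoff n\<close> is zero wherever
  \<open>real n * profile k x\<close> is at most 1. A finite sum of smooth functions avoids gluing
  across the spheres.\<close>

definition approx :: "nat \<Rightarrow> 'a \<Rightarrow> real" where
  "approx n x = (\<Sum>k<N. cutoff n (profile k x))"

lemma norm_field_le: "norm (field x) \<le> 1 / real DIM('a)"
  using norm_offset_less[of x] by (simp add: field_def divide_simps)

lemma field_measurable: "field \<in> borel_measurable (lebesgue_on (balls 1))"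
proof -
  have "field \<in> borel_measurable borel"
    unfolding field_def[abs_def] using offset_borel by measurable
  then show ?thesis by (intro measurable_restrict_space1 measurable_completion) simp
qed

sublocale unit_divergence_field "balls 1" field "1 / real DIM('a)"
proof
  fix \<psi> :: "'a \<Rightarrow> real" assume "\<psi> \<in> test_functions (balls 1)"
  from offset_divergence[OF this]
  show "(\<integral>x. field x \<bullet> grad \<psi> x \<partial>lebesgue_on (balls 1)) = - (\<integral>x. \<psi> x \<partial>lebesgue_on (balls 1))"
    by (simp add: field_def)
qed (auto intro: balls_open balls_lmeasurable field_measurable norm_field_le)

lemma torsion_bounds: "0 < torsion x" "torsion x \<le> 1"
proof -
  have "(norm (offset x))\<^sup>2 < 1"
    using norm_offset_less[of x] by (simp add: power_less_one_iff)
  then show "0 < torsion x" by (simp add: torsion_def)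
  have "1 \<le> real DIM('a)" using DIM_positive[where 'a = 'a] by linarith
  then have "1 - (norm (offset x))\<^sup>2 \<le> 2 * real DIM('a)"
    using zero_le_power2[of "norm (offset x)"] by linarith
  then show "torsion x \<le> 1" by (simp add: torsion_def)
qed

lemma torsion_L2: "torsion \<in> L2 (balls 1)"
proof (rule bounded_L2[OF balls_lmeasurable])
  have "torsion \<in> borel_measurable borel"
    unfolding torsion_def[abs_def] using offset_borel by measurable
  then show "torsion \<in> borel_measurable (lebesgue_on (balls 1))"
    by (intro measurable_restrict_space1 measurable_completion) simp
  show "norm (torsion x) \<le> 1" for x using torsion_bounds[of x] by simp
qed

lemma profile_Ck: "Ck m (profile k)"
proof -
  have "Ck m (\<lambda>x. x \<bullet> i)" for i :: 'a
    by (rule Ck_bounded_linear) (rule bounded_linear_inner_left)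
  then have "Ck m (\<lambda>x. (1 / (2 * real DIM('a))) * (1 - (\<Sum>i\<in>Basis. (x \<bullet> i - a k \<bullet> i) * (x \<bullet> i - a k \<bullet> i))))"
    by (intro Ck_mult Ck_diff Ck_sum Ck_const)
  also have "(\<lambda>x. (1 / (2 * real DIM('a))) * (1 - (\<Sum>i\<in>Basis. (x \<bullet> i - a k \<bullet> i) * (x \<bullet> i - a k \<bullet> i)))) = profile k"
  proof
    fix x
    have "(x - a k) \<bullet> (x - a k) = (\<Sum>i\<in>Basis. (x \<bullet> i - a k \<bullet> i) * (x \<bullet> i - a k \<bullet> i))"
      by (subst euclidean_inner) (simp add: inner_diff_left)
    then show "(1 / (2 * real DIM('a))) * (1 - (\<Sum>i\<in>Basis. (x \<bullet> i - a k \<bullet> i) * (x \<bullet> i - a k \<bullet> i))) = profile k x"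
      by (simp add: profile_def)
  qed
  finally show ?thesis .
qed

lemma profile_derivative:
  "(profile k has_derivative (\<lambda>v. (- ((x - a k) /\<^sub>R real DIM('a))) \<bullet> v)) (at x)"
proof -
  have "((\<lambda>x. 1 - (x - a k) \<bullet> (x - a k)) has_derivative (\<lambda>v. - (2 * ((x - a k) \<bullet> v)))) (at x)"
    by (auto intro!: derivative_eq_intros simp: inner_commute)
  then have D: "((\<lambda>x. 1 / (2 * real DIM('a)) * (1 - (x - a k) \<bullet> (x - a k))) has_derivative
      (\<lambda>v. 1 / (2 * real DIM('a)) * - (2 * ((x - a k) \<bullet> v)))) (at x)"
    by (rule has_derivative_mult_right)
  have e1: "(\<lambda>v. 1 / (2 * real DIM('a)) * - (2 * ((x - a k) \<bullet> v))) =
      (\<lambda>v. (- ((x - a k) /\<^sub>R real DIM('a))) \<bullet> v)"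
    by (rule ext) (simp only: inner_minus_left inner_scaleR_left, simp add: field_simps)
  have e2: "(\<lambda>x. 1 / (2 * real DIM('a)) * (1 - (x - a k) \<bullet> (x - a k))) = profile k"
    by (simp add: profile_def[abs_def])
  show ?thesis using has_derivative_eq_rhs[OF D e1] unfolding e2 .
qed

lemma approx_Ck: "Ck m (approx n)"
  unfolding approx_def[abs_def] cutoff_def
  by (intro Ck_sum Ck_mult Ck_flat Ck_diff Ck_const profile_Ck)

lemma grad_approx:
  "grad (approx n) x = (\<Sum>k<N. flat [:1, 1:] (real n * profile k x - 1) *\<^sub>R (- ((x - a k) /\<^sub>R real DIM('a))))"
proof (rule grad_eqI)
  have "((\<lambda>x. cutoff n (profile k x)) has_derivative
      (\<lambda>v. flat [:1, 1:] (real n * profile k x - 1) * ((- ((x - a k) /\<^sub>R real DIM('a))) \<bullet> v))) (at x)" for k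
    by (rule has_derivative_compose[OF profile_derivative cutoff_derivative[unfolded has_field_derivative_def]])
  then have "(approx n has_derivative
      (\<lambda>v. \<Sum>k<N. flat [:1, 1:] (real n * profile k x - 1) * ((- ((x - a k) /\<^sub>R real DIM('a))) \<bullet> v))) (at x)"
    unfolding approx_def[abs_def] by (rule has_derivative_sum)
  moreover have "(\<lambda>v. \<Sum>k<N. flat [:1, 1:] (real n * profile k x - 1) * ((- ((x - a k) /\<^sub>R real DIM('a))) \<bullet> v)) =
      (\<bullet>) (\<Sum>k<N. flat [:1, 1:] (real n * profile k x - 1) *\<^sub>R (- ((x - a k) /\<^sub>R real DIM('a))))"
    by (rule ext) (simp only: inner_sum_left inner_scaleR_left)
  ultimately show "(approx n has_derivative
      (\<bullet>) (\<Sum>k<N. flat [:1, 1:] (real n * profile k x - 1) *\<^sub>R (- ((x - a k) /\<^sub>R real DIM('a))))) (at x)"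
    by simp
qed

lemma profile_nonpos:
  assumes "1 \<le> dist (a k) x"
  shows "profile k x \<le> 0"
proof -
  have "1 \<le> (norm (x - a k))\<^sup>2"
    using assms power_mono[of 1 "norm (x - a k)" 2] by (simp add: dist_norm norm_minus_commute)
  then show ?thesis
    unfolding profile_def dot_square_norm by (intro divide_nonpos_nonneg) auto
qed

text \<open>In the ball around \<open>a k\<close> all other profiles are nonpositive, so exactly one
  summand and one gradient term can survive.\<close>

lemma approx_eq:
  assumes "x \<in> balls 1"
  shows "approx n x = cutoff n (torsion x)"
    and "grad (approx n) x = flat [:1, 1:] (real n * torsion x - 1) *\<^sub>R (- field x)"
proof -
  obtain k where k: "k < N" "x \<in> ball (a k) 1" "offset x = x - a k"
    using assms by (rule ball_cases)
  have p: "profile k x = torsion x"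
    by (simp add: profile_def torsion_def k(3) dot_square_norm)
  have np: "real n * profile j x - 1 \<le> 0" if "j \<noteq> k" for j
    using mult_nonneg_nonpos[OF of_nat_0_le_iff profile_nonpos[of j x], of n]
      far_from_other_centres[OF k(2) that] by simp
  have "approx n x = (\<Sum>j<N. if j = k then cutoff n (torsion x) else 0)"
    unfolding approx_def by (intro sum.cong refl) (auto simp: p cutoff_def flat0_nonpos[OF np])
  then show "approx n x = cutoff n (torsion x)" using k(1) by simp
  have z: "flat [:1, 1:] (real n * profile j x - 1) = 0" if "j \<noteq> k" for j
    using np[OF that] by (simp add: flat_def)
  have "grad (approx n) x = (\<Sum>j<N. if j = k then flat [:1, 1:] (real n * torsion x - 1) *\<^sub>R (- field x) else 0)"
    unfolding grad_approx by (intro sum.cong refl) (auto simp: p z field_def k(3))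
  then show "grad (approx n) x = flat [:1, 1:] (real n * torsion x - 1) *\<^sub>R (- field x)"
    using k(1) by simp
qed

lemma approx_test_function: "approx n \<in> test_functions (balls 1)"
proof (rule test_functionI[OF approx_Ck])
  \<comment> \<open>A closed superlevel set that contains the support of the \<open>k\<close>-th
    summand. It lies in the open ball, where alone the profile is positive, and is empty for
    \<open>n = 0\<close>.\<close>
  let ?K = "\<lambda>k. {x. 1 \<le> real n * profile k x}"
  have sub: "?K k \<subseteq> ball (a k) 1" for k
  proof
    fix x assume "x \<in> ?K k"
    then have "\<not> profile k x \<le> 0"
      using mult_nonneg_nonpos[of "real n" "profile k x"] by auto
    then show "x \<in> ball (a k) 1" using profile_nonpos[of k x] by force
  qed
  have "closed (?K k)" for k
    by (intro closed_Collect_le continuous_intros Ck_continuous[OF profile_Ck])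
  moreover have "bounded (?K k)" for k
    using bounded_subset[OF bounded_ball sub] .
  ultimately have "compact (?K k)" for k by (simp add: compact_eq_bounded_closed)
  then show "compact (\<Union>k<N. ?K k)" by (intro compact_UN) auto
  show "(\<Union>k<N. ?K k) \<subseteq> balls 1" unfolding balls_def by (intro UN_mono order_refl sub)
  fix x assume "x \<notin> (\<Union>k<N. ?K k)"
  then have "\<not> 1 \<le> real n * profile k x" if "k < N" for k
    using that by blast
  then have "real n * profile k x - 1 \<le> 0" if "k < N" for k
    using that by force
  then have "cutoff n (profile k x) = 0" if "k < N" for k
    using that by (simp only: cutoff_def flat0_nonpos mult_zero_right)
  then show "approx n x = 0" by (simp add: approx_def)
qed

text \<open>The errors are \<open>torsion x - cutoff n (torsion x)\<close> and (1 - slope) times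
  \<open>- field x\<close>. Since \<open>torsion\<close> is positive throughout the open balls, both
  tend to 0 pointwise; both are bounded by 1 on a set of finite measure.\<close>

lemma torsion_H10:
  shows "torsion \<in> H10 (balls 1)"
    and "AE x in lebesgue_on (balls 1). weak_grad (balls 1) torsion x = - field x"
proof -
  note t = test_function_L2[OF approx_test_function domain_sets]
  note nf = L2_minus(1)[OF V_L2]
  have l1: "(\<lambda>n. L2_norm (balls 1) (\<lambda>x. torsion x - approx n x)) \<longlonglongrightarrow> 0"
  proof (rule L2_norm_tendsto_0[OF balls_lmeasurable L2_diff_triangle(1)[OF torsion_L2 t(1)]])
    fix x assume x: "x \<in> balls 1"
    show "norm (torsion x - approx n x) \<le> 1" for n
      using cutoff_bounds[of "torsion x" n] torsion_bounds[of x] by (simp add: approx_eq(1)[OF x])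
    have "(\<lambda>n. torsion x - cutoff n (torsion x)) \<longlonglongrightarrow> torsion x - torsion x"
      by (intro tendsto_intros cutoff_tendsto torsion_bounds)
    then show "(\<lambda>n. torsion x - approx n x) \<longlonglongrightarrow> 0" by (simp add: approx_eq(1)[OF x])
  qed
  have l2: "(\<lambda>n. L2_norm (balls 1) (\<lambda>x. - field x - grad (approx n) x)) \<longlonglongrightarrow> 0"
  proof (rule L2_norm_tendsto_0[OF balls_lmeasurable L2_diff_triangle(1)[OF nf t(2)]])
    fix x assume x: "x \<in> balls 1"
    have e: "- field x - grad (approx n) x = (1 - flat [:1, 1:] (real n * torsion x - 1)) *\<^sub>R (- field x)" for n
      unfolding approx_eq(2)[OF x] by (simp add: scaleR_diff_left)
    have "1 / real DIM('a) \<le> 1" using DIM_positive[where 'a = 'a] by (simp add: Suc_le_eq)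
    then have "norm (field x) \<le> 1" using norm_field_le[of x] by linarith
    then show "norm (- field x - grad (approx n) x) \<le> 1" for n
      unfolding e norm_scaleR norm_minus_cancel using flat_slope_bounds[of "real n * torsion x - 1"]
      by (intro mult_le_one) auto
    \<comment> \<open>The slope tends to \<open>poly [:1, 1:] 0 = 1\<close> because
      \<open>torsion x\<close> is positive.\<close>
    have "(\<lambda>n. (1 - flat [:1, 1:] (real n * torsion x - 1)) *\<^sub>R (- field x)) \<longlonglongrightarrow> (1 - 1) *\<^sub>R (- field x)"
      using flat_scaled_tendsto[of 1 "[:1, 1:]" "torsion x"] torsion_bounds(1)[of x]
      by (intro tendsto_intros) simp
    then show "(\<lambda>n. - field x - grad (approx n) x) \<longlonglongrightarrow> 0" unfolding e by simp
  qed
  have ap: "\<exists>\<phi>\<in>test_functions (balls 1). L2_norm (balls 1) (\<lambda>x. torsion x - \<phi> x) < e \<and>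
      L2_norm (balls 1) (\<lambda>x. - field x - grad \<phi> x) < e" if "0 < e" for e
  proof -
    have "\<forall>\<^sub>F n in sequentially. L2_norm (balls 1) (\<lambda>x. torsion x - approx n x) < e \<and>
        L2_norm (balls 1) (\<lambda>x. - field x - grad (approx n) x) < e"
      using order_tendstoD(2)[OF l1 that] order_tendstoD(2)[OF l2 that] by eventually_elim simp
    then obtain n where "L2_norm (balls 1) (\<lambda>x. torsion x - approx n x) < e"
        "L2_norm (balls 1) (\<lambda>x. - field x - grad (approx n) x) < e"
      by (auto simp: eventually_sequentially)
    then show ?thesis using approx_test_function[of n] by blast
  qed
  show "torsion \<in> H10 (balls 1)" by (rule H10I(1)[OF balls_open torsion_L2 nf ap])
  show "AE x in lebesgue_on (balls 1). weak_grad (balls 1) torsion x = - field x"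
    by (rule H10I(2)[OF balls_open torsion_L2 nf ap])
qed

lemma torsional_rigidity_balls: "torsional_rigidity (balls 1) = (\<integral>x. torsion x \<partial>lebesgue_on (balls 1))"
  by (rule torsional_rigidity_eq[OF torsion_weak_solutionI[OF torsion_H10]])

text \<open>At distance less than \<open>1/2\<close> from a centre, the torsion function is at least \<open>3 / (8 d)\<close>.\<close>

lemma integral_torsion_ge:
  "3 / (8 * real DIM('a)) * measure lebesgue (balls (1/2)) \<le> (\<integral>x. torsion x \<partial>lebesgue_on (balls 1))"
proof -
  have sub: "balls (1/2) \<subseteq> balls 1"
    unfolding balls_def by (intro UN_mono order_refl subset_ball) simp
  have h: "balls (1/2) \<in> sets lebesgue" using balls_open by auto
  have one: "(\<lambda>_. 1 :: real) \<in> L2 (balls 1)"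
    by (rule bounded_L2[OF balls_lmeasurable, where B = 1]) auto
  have ti: "integrable (lebesgue_on (balls 1)) torsion"
    by (rule L2_bilinear_bound(1)[OF one torsion_L2 L2_measurable[OF torsion_L2]]) simp
  have "3 / (8 * real DIM('a)) * measure lebesgue (balls (1/2)) = (\<integral>x. 3 / (8 * real DIM('a)) \<partial>lebesgue_on (balls (1/2)))"
    using h by (simp add: measure_restrict_space)
  also have "\<dots> \<le> (\<integral>x. torsion x \<partial>lebesgue_on (balls 1))"
  proof (rule integral_mono_lebesgue_on_AE[OF ti _ _ sub h domain_sets])
    show "AE x in lebesgue_on (balls 1). 0 \<le> torsion x"
      using torsion_bounds(1) by (intro AE_I2 less_imp_le)
    have "3 / (8 * real DIM('a)) \<le> torsion x" if x: "x \<in> balls (1/2)" for x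
    proof -
      obtain k where k: "k < N" "x \<in> ball (a k) (1/2)" using x by (auto simp: balls_def)
      then have "offset x = x - a k" by (intro offset_ball) auto
      then have "norm (offset x) \<le> 1/2" using k(2) by (simp add: dist_norm norm_minus_commute)
      then have "(norm (offset x))\<^sup>2 \<le> (1/2)\<^sup>2" by (intro power_mono) auto
      then show ?thesis by (simp add: torsion_def power2_eq_square field_simps)
    qed
    then show "AE x in lebesgue_on (balls (1/2)). 3 / (8 * real DIM('a)) \<le> torsion x"
      by (intro AE_I2) simp
  qed
  finally show ?thesis .
qed

end

section \<open>Growth of \<open>F q\<close> with the number of balls\<close>

context separated_balls
begin

text \<open>The volume is exact, whereas eigenvalue and torsional rigidity are replaced by lower
  bounds; this is legitimate because \<open>F q\<close> increases in both for \<open>q > 0\<close>.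
  The factor d^2/4 is 1 / (4 M^2) with M = 1/d.\<close>

lemma F_balls_ge:
  assumes "0 < q" "q < 1" "0 < N"
  defines "d \<equiv> real DIM('a)"
  defines "\<beta> \<equiv> unit_ball_vol (real DIM('a))"
  defines "\<alpha> \<equiv> (d * q + 2 * q - 2) / d"
  shows "F q (balls 1) \<ge> d\<^sup>2 / 4 * (3 / (8 * d) * (\<beta> * (1/2) ^ DIM('a))) powr q / \<beta> powr \<alpha> * real N powr (2 * (1 - q) / d)"
    and "measure lebesgue (balls 1) > 0"
proof -
  have d: "0 < d" using DIM_positive[where 'a = 'a] by (simp add: d_def)
  have \<beta>: "0 < \<beta>" by (simp add: \<beta>_def)
  \<comment> \<open>The contribution of one ball to the torsional rigidity: the pointwise bound
    3/(8d) times the volume of a ball of radius 1/2.\<close>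
  define c where "c = 3 / (8 * d) * (\<beta> * (1/2) ^ DIM('a))"
  have c: "0 < c" using d \<beta> by (simp add: c_def)
  have N: "0 < real N" using assms(3) by simp
  have vol: "measure lebesgue (balls 1) = real N * \<beta>"
    using measure_balls[of 1] by (simp add: \<beta>_def)
  then show "measure lebesgue (balls 1) > 0" using N \<beta> by simp
  have T: "c * real N \<le> (\<integral>x. torsion x \<partial>lebesgue_on (balls 1))"
    using integral_torsion_ge measure_balls[of "1/2"] by (simp add: c_def d_def \<beta>_def field_simps)
  \<comment> \<open>The positive integral makes \<open>torsion\<close> an admissible competitor, so
    the infimum defining the eigenvalue is over a nonempty set.\<close>
  have "\<not> (AE x in lebesgue_on (balls 1). torsion x = 0)"
  proof
    assume "AE x in lebesgue_on (balls 1). torsion x = 0"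
    then have "(\<integral>x. torsion x \<partial>lebesgue_on (balls 1)) = 0" by (rule integral_eq_zero_AE)
    with T mult_pos_pos[OF c N] show False by simp
  qed
  from dirichlet_eigenvalue_ge[OF _ torsion_H10(1) this] d
  have \<lambda>: "d\<^sup>2 / 4 \<le> dirichlet_eigenvalue (balls 1)"
    by (simp add: d_def power_divide)
  have "d\<^sup>2 / 4 * c powr q / \<beta> powr \<alpha> * real N powr (2 * (1 - q) / d) =
      d\<^sup>2 / 4 * (c * real N) powr q / (real N * \<beta>) powr \<alpha>"
  proof -
    have "2 * (1 - q) / d = q - \<alpha>" using d by (simp add: \<alpha>_def field_simps)
    then show ?thesis using c N \<beta> by (simp add: powr_mult powr_diff mult_ac)
  qed
  also have "\<dots> \<le> F q (balls 1)"
    unfolding F_def torsional_rigidity_balls vol \<alpha>_def d_def[symmetric]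
    using \<lambda> T c N assms(1) order_trans[OF _ \<lambda>, of 0] by (intro divide_right_mono mult_mono powr_mono2) auto
  finally show "F q (balls 1) \<ge> d\<^sup>2 / 4 * (3 / (8 * d) * (\<beta> * (1/2) ^ DIM('a))) powr q / \<beta> powr \<alpha> * real N powr (2 * (1 - q) / d)"
    by (simp only: c_def)
qed

end

theorem proposition3p3:
  fixes q :: real
  assumes "0 < q" and "q < 1"
  shows "(SUP \<Omega> \<in> {\<Omega> :: (real ^ 'd::finite) set.
             open \<Omega> \<and> 0 < emeasure lebesgue \<Omega> \<and> emeasure lebesgue \<Omega> < \<infinity>}.
           ereal (F q \<Omega>)) = \<infinity>"
proof (rule SUP_PInfty)
  fix n :: nat
  obtain e :: "real ^ 'd" where e: "e \<in> Basis" using nonempty_Basis by blast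
  define a where "a k = (2 * real k) *\<^sub>R e" for k
  \<comment> \<open>The locale predicate does not depend on \<open>N\<close>, so the centres, spaced
    by 2 along a line, are checked before the number of balls is known.\<close>
  have balls: "separated_balls a"
  proof
    fix i j :: nat assume "i \<noteq> j"
    then have "1 \<le> \<bar>real i - real j\<bar>" by linarith
    moreover have "a i - a j = (2 * (real i - real j)) *\<^sub>R e"
      by (simp only: a_def right_diff_distrib scaleR_diff_left)
    then have "dist (a i) (a j) = 2 * \<bar>real i - real j\<bar>"
      using e by (simp only: dist_norm norm_scaleR norm_Basis abs_mult)
    ultimately show "2 \<le> dist (a i) (a j)" by simp
  qed
  define d where "d = real DIM(real ^ 'd)"
  define C where "C = d\<^sup>2 / 4 * (3 / (8 * d) * (unit_ball_vol d * (1/2) ^ DIM(real ^ 'd))) powr q /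
    unit_ball_vol d powr ((d * q + 2 * q - 2) / d)"
  have d: "0 < d" by (simp add: d_def)
  have vol: "0 < unit_ball_vol d" using d by simp
  have "0 < 3 / (8 * d) * (unit_ball_vol d * (1/2) ^ DIM(real ^ 'd))"
    using d vol by (intro mult_pos_pos divide_pos_pos zero_less_power) auto
  then have C: "0 < C"
    unfolding C_def using d vol less_imp_neq[OF vol] by (intro divide_pos_pos mult_pos_pos powr_gt_zero[THEN iffD2]) auto
  define s where "s = 2 * (1 - q) / d"
  have s: "0 < s" using d assms by (simp add: s_def)
  \<comment> \<open>This solves C N^s \<ge> n for N. The summand 1 keeps the base of the power
    positive even for \<open>n = 0\<close>, so that \<open>0 < N\<close> follows too.\<close>
  obtain N :: nat where "(real n / C + 1) powr (1 / s) < real N"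
    using reals_Archimedean2 by blast
  moreover have pos: "0 < real n / C + 1"
    using C by (intro add_nonneg_pos) auto
  then have "0 < (real n / C + 1) powr (1 / s)" by simp
  ultimately have N0: "0 < N" and "((real n / C + 1) powr (1 / s)) powr s \<le> real N powr s"
    using s by (auto intro!: powr_mono2 simp del: powr_gt_zero)
  then have "real n / C + 1 \<le> real N powr s"
    using s pos by (simp add: powr_powr)
  then have "C * (real n / C + 1) \<le> C * real N powr s"
    using C by (intro mult_left_mono) auto
  then have "real n \<le> C * real N powr s"
    using C by (simp add: distrib_left)
  then have N: "real n \<le> C * real N powr (2 * (1 - q) / d)" "0 < N"
    using N0 by (simp_all add: s_def)
  interpret separated_balls a N by (rule balls)
  have "real n \<le> F q (balls 1)"
    using N(1) F_balls_ge(1)[OF assms N(2)] unfolding C_def d_def by linarith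
  moreover have "0 < emeasure lebesgue (balls 1)" "emeasure lebesgue (balls 1) < \<infinity>"
    using F_balls_ge(2)[OF assms N(2)] balls_lmeasurable[of 1]
    by (auto simp: fmeasurable_def measure_def enn2real_positive_iff)
  ultimately show "\<exists>\<Omega>\<in>{\<Omega> :: (real ^ 'd) set. open \<Omega> \<and> 0 < emeasure lebesgue \<Omega> \<and> emeasure lebesgue \<Omega> < \<infinity>}.
      ereal (real n) \<le> ereal (F q \<Omega>)"
    using balls_open[of 1] by (intro bexI[of _ "balls 1"]) auto
qed

end
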